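(* Let $G$ be a topological group and let $H$ be a prodiscrete normal subgroup of $G$ such that the quotient $\frac{G}{H}$ is a connected, locally path connected space. Then the natural canonical homomorphism $\varphi:G\to \frac{G}{H}$ is a generalized covering homomorphism.
   Context: A continuous map $p:(\widetilde X,\tilde x_0)\to (X,x_0)$ has the unique lifting property if for every connected, locally path connected space $(Y,y_0)$ and every continuous map $f:(Y,y_0)\to (X,x_0)$ with $f_*\pi_1(Y,y_0)\subseteq p_*\pi_1(\widetilde X,\tilde x_0)$ there exists a unique continuous map $\tilde f:(Y,y_0)\to(\widetilde X,\tilde x_0)$ with $p\circ \tilde f=f$. If moreover $\widetilde X$ is connected and locally path connected, then $p$ is called a generalized covering map and $(\widetilde X,p)$ a generalized covering space of $X$. A generalized covering group of a topological group $G$ (with identity $e$) is a pair $(\widetilde G,p)$ consisting of a topological group $\widetilde G$ (with identity $\tilde e$) and a homomorphism $p:(\widetilde G,\tilde e)\to (G,e)$ such that $(\widetilde G,p)$ is a generalized covering space of $G$; the homomorphism $p$ is then called a generalized covering homomorphism. A subgroup $H$ of a topological group $G$ is called prodiscrete if there are discrete groups $H_i$, $i\in I$, and a map $\psi:\prod_{i\in I}H_i\to H$ which is both a group isomorphism and a homeomorphism (product topology on the product, subspace topology on $H$) such that for every $j\in I$ the subgroup $\psi\big(\prod_{i\in I,\, i\ne j}H_i\big)$ is normal in $G$, where $\prod_{i\in I,\,i\neq j}H_i$ is identified with the subgroup of those families whose $j$-th coordinate is trivial. $\frac{G}{H}$ carries the quotient topology.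
   Formalization: False as stated if G is not connected and locally path connected (G = H = Z/2 discrete); φ is shown to be a generalized covering homomorphism when G has both properties, and without them to be a homomorphism of topological groups with the unique lifting property. *)

theory Defs
  imports "HOL-Analysis.Analysis" "HOL-Algebra.Product_Groups"
begin

subsection \<open>The fundamental group and induced maps\<close>

definition loops_at :: "'a topology \<Rightarrow> 'a \<Rightarrow> (real \<Rightarrow> 'a) set" where
  "loops_at X x0 = {g. pathin X g \<and> g 0 = x0 \<and> g 1 = x0}"

text \<open>The homotopy class, relative to the endpoints, of a loop at the base point. Values of
  a path outside the unit interval are irrelevant, and the class identifies paths that differ
  only there.\<close>

definition loop_class :: "'a topology \<Rightarrow> 'a \<Rightarrow> (real \<Rightarrow> 'a) \<Rightarrow> (real \<Rightarrow> 'a) set" where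
  "loop_class X x0 g =
     {g'. homotopic_with (\<lambda>r. r 0 = x0 \<and> r 1 = x0) (top_of_set {0..1}) X g g'}"

text \<open>Only the underlying set of the fundamental group is introduced: the lifting property
  compares images of fundamental groups merely by inclusion.\<close>

definition fundamental_group_set :: "'a topology \<Rightarrow> 'a \<Rightarrow> (real \<Rightarrow> 'a) set set" where
  "fundamental_group_set X x0 = loop_class X x0 ` loops_at X x0"

definition induced_map ::
  "'b topology \<Rightarrow> 'b \<Rightarrow> ('a \<Rightarrow> 'b) \<Rightarrow> (real \<Rightarrow> 'a) set \<Rightarrow> (real \<Rightarrow> 'b) set" where
  "induced_map Y y0 f c = (\<Union>g\<in>c. loop_class Y y0 (f \<circ> g))"

lemma loop_class_self: "g \<in> loops_at X x0 \<Longrightarrow> g \<in> loop_class X x0 g"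
  by (simp add: loops_at_def loop_class_def pathin_def)

lemma loop_class_eq:
  assumes "g' \<in> loop_class X x0 g"
  shows "loop_class X x0 g' = loop_class X x0 g"
proof -
  have *: "homotopic_with (\<lambda>r. r 0 = x0 \<and> r 1 = x0) (top_of_set {0..1}) X g g'"
    using assms by (simp add: loop_class_def)
  show ?thesis
    using homotopic_with_trans[OF *] homotopic_with_trans[OF homotopic_with_symD[OF *]]
    by (auto simp: loop_class_def)
qed

lemma induced_map_loop_class:
  assumes f: "continuous_map X Y f" "f x0 = y0" and g: "g \<in> loops_at X x0"
  shows "induced_map Y y0 f (loop_class X x0 g) = loop_class Y y0 (f \<circ> g)"
proof -
  have "f \<circ> g' \<in> loop_class Y y0 (f \<circ> g)" if "g' \<in> loop_class X x0 g" for g'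
    using that f unfolding loop_class_def
    by (auto intro!: homotopic_with_compose_continuous_map_left)
  then show ?thesis
    using loop_class_self[OF g] loop_class_eq[of "f \<circ> _" Y y0 "f \<circ> g"]
    unfolding induced_map_def by (smt (verit) SUP_eq_const empty_iff)
qed


subsection \<open>Generalized covering maps\<close>

text \<open>The phantom argument fixes the type of the points of the test spaces, since HOL cannot
  quantify over types inside a definition; a theorem whose conclusion is this property for a
  free type variable covers test spaces of every type. Lifts are taken to be extensional so
  that uniqueness means uniqueness on the underlying set of the test space.\<close>

definition unique_lifting_property ::
  "'y itself \<Rightarrow> 'a topology \<Rightarrow> 'a \<Rightarrow> 'b topology \<Rightarrow> 'b \<Rightarrow> ('a \<Rightarrow> 'b) \<Rightarrow> bool" where
  "unique_lifting_property TYPE('y) X' x0' X x0 p \<longleftrightarrow>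
     x0' \<in> topspace X' \<and> continuous_map X' X p \<and> p x0' = x0 \<and>
     (\<forall>(Y :: 'y topology) y0 f.
        y0 \<in> topspace Y \<and> connected_space Y \<and> locally_path_connected_space Y \<and>
        continuous_map Y X f \<and> f y0 = x0 \<and>
        induced_map X x0 f ` fundamental_group_set Y y0
          \<subseteq> induced_map X x0 p ` fundamental_group_set X' x0' \<longrightarrow>
        (\<exists>!f'. f' \<in> extensional (topspace Y) \<and> continuous_map Y X' f' \<and> f' y0 = x0' \<and>
               (\<forall>y \<in> topspace Y. p (f' y) = f y)))"

definition generalized_covering_map ::
  "'y itself \<Rightarrow> 'a topology \<Rightarrow> 'a \<Rightarrow> 'b topology \<Rightarrow> 'b \<Rightarrow> ('a \<Rightarrow> 'b) \<Rightarrow> bool" where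
  "generalized_covering_map TYPE('y) X' x0' X x0 p \<longleftrightarrow>
     unique_lifting_property TYPE('y) X' x0' X x0 p \<and>
     connected_space X' \<and> locally_path_connected_space X'"


subsection \<open>Topological groups\<close>

text \<open>No separation axiom is imposed.\<close>

definition topological_group :: "('g, 'm) monoid_scheme \<Rightarrow> 'g topology \<Rightarrow> bool" where
  "topological_group G T \<longleftrightarrow>
     group G \<and> topspace T = carrier G \<and>
     continuous_map (prod_topology T T) T (\<lambda>(x, y). x \<otimes>\<^bsub>G\<^esub> y) \<and>
     continuous_map T T (\<lambda>x. inv\<^bsub>G\<^esub> x)"

definition generalized_covering_homomorphism ::
  "'y itself \<Rightarrow> ('a, 'm) monoid_scheme \<Rightarrow> 'a topology \<Rightarrow>
   ('b, 'n) monoid_scheme \<Rightarrow> 'b topology \<Rightarrow> ('a \<Rightarrow> 'b) \<Rightarrow> bool" where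
  "generalized_covering_homomorphism TYPE('y) G' T' G T p \<longleftrightarrow>
     topological_group G' T' \<and> topological_group G T \<and> p \<in> hom G' G \<and>
     generalized_covering_map TYPE('y) T' \<one>\<^bsub>G'\<^esub> T \<one>\<^bsub>G\<^esub> p"

text \<open>The phantom arguments fix the types of the indices and of the elements of the discrete
  factors. A theorem assuming this property for free type variables covers all families:
  the members of any set-indexed family of groups can be realised in one common type.\<close>

definition prodiscrete ::
  "'i itself \<Rightarrow> 'h itself \<Rightarrow> ('g, 'm) monoid_scheme \<Rightarrow> 'g topology \<Rightarrow> 'g set \<Rightarrow> bool" where
  "prodiscrete TYPE('i) TYPE('h) G T H \<longleftrightarrow>
     subgroup H G \<and>
     (\<exists>(I :: 'i set) (D :: 'i \<Rightarrow> 'h monoid) \<psi>.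
        (\<forall>i\<in>I. group (D i)) \<and>
        \<psi> \<in> iso (product_group I D) (G\<lparr>carrier := H\<rparr>) \<and>
        homeomorphic_map (product_topology (\<lambda>i. discrete_topology (carrier (D i))) I)
          (subtopology T H) \<psi> \<and>
        (\<forall>j\<in>I. \<psi> ` {x \<in> carrier (product_group I D). x j = \<one>\<^bsub>D j\<^esub>} \<lhd> G))"

definition quotient_topology :: "'a topology \<Rightarrow> ('a \<Rightarrow> 'b) \<Rightarrow> 'b topology" where
  "quotient_topology X q =
     topology (\<lambda>U. U \<subseteq> q ` topspace X \<and> openin X {x \<in> topspace X. q x \<in> U})"

lemma openin_quotient_topology:
  "openin (quotient_topology X q) U \<longleftrightarrow>
     U \<subseteq> q ` topspace X \<and> openin X {x \<in> topspace X. q x \<in> U}"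
proof -
  have "istopology (\<lambda>U. U \<subseteq> q ` topspace X \<and> openin X {x \<in> topspace X. q x \<in> U})"
    unfolding istopology_def
  proof (intro conjI allI impI)
    fix S U
    assume "S \<subseteq> q ` topspace X \<and> openin X {x \<in> topspace X. q x \<in> S}"
      and "U \<subseteq> q ` topspace X \<and> openin X {x \<in> topspace X. q x \<in> U}"
    moreover have "{x \<in> topspace X. q x \<in> S \<inter> U} =
        {x \<in> topspace X. q x \<in> S} \<inter> {x \<in> topspace X. q x \<in> U}" by blast
    ultimately show "S \<inter> U \<subseteq> q ` topspace X" "openin X {x \<in> topspace X. q x \<in> S \<inter> U}"
      by auto
  next
    fix \<K>
    assume *: "\<forall>K\<in>\<K>. K \<subseteq> q ` topspace X \<and> openin X {x \<in> topspace X. q x \<in> K}"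
    then show "\<Union>\<K> \<subseteq> q ` topspace X" by blast
    have "{x \<in> topspace X. q x \<in> \<Union>\<K>} = (\<Union>K\<in>\<K>. {x \<in> topspace X. q x \<in> K})" by blast
    then show "openin X {x \<in> topspace X. q x \<in> \<Union>\<K>}"
      using * by auto
  qed
  then show ?thesis
    by (simp add: quotient_topology_def topology_inverse')
qed

lemma topspace_quotient_topology [simp]:
  "topspace (quotient_topology X q) = q ` topspace X"
proof -
  have "{x \<in> topspace X. q x \<in> q ` topspace X} = topspace X" by blast
  then have "openin (quotient_topology X q) (q ` topspace X)"
    by (simp add: openin_quotient_topology)
  then show ?thesis
    by (meson openin_quotient_topology openin_subset openin_topspace subset_antisym)
qed

lemma quotient_map_quotient_topology: "quotient_map X (quotient_topology X q) q"
  by (auto simp: quotient_map_def openin_quotient_topology)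

definition coset_topology :: "('g, 'm) monoid_scheme \<Rightarrow> 'g topology \<Rightarrow> 'g set \<Rightarrow> 'g set topology"
  where "coset_topology G T H = quotient_topology T (\<lambda>g. H #>\<^bsub>G\<^esub> g)"

end

theory Submission
  imports Defs
begin

text \<open>
Write \<open>q : G \<rightarrow> G/H\<close> for the quotient map and \<open>K\<^sub>j\<close> for the kernel of the \<open>j\<close>-th coordinate of the
product \<open>H\<close>. Each \<open>K\<^sub>j\<close> is normal in \<open>G\<close> and open in \<open>H\<close>, so \<open>H/K\<^sub>j\<close> is discrete and
\<open>G/K\<^sub>j \<rightarrow> G/H\<close> behaves like a covering; that \<open>H\<close> is the full product says that \<open>H\<close> is the
limit of its discrete quotients, and therefore \<open>G\<close> is the limit of these coverings. The lifting
problem is solved for paths and homotopies first and then transported to arbitrary test spaces.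

Everything rests on one connectedness argument (\<open>connected_stays_in_translates\<close>). Let \<open>K\<close> be a
subgroup that is open in \<open>H\<close>, and let \<open>M\<close> be a neighbourhood of the unit so small that
\<open>x\<inverse>y \<in> H\<close> forces \<open>x\<inverse>y \<in> K\<close> for \<open>x, y \<in> M\<close>. Then \<open>MK\<close> and \<open>M(H - K)\<close> are disjoint
open sets covering \<open>MH\<close>, so a connected family in \<open>G\<close> that starts at the unit and whose image
in \<open>G/H\<close> stays in \<open>q(M)\<close> must stay in \<open>MK\<close>. This has three consequences.

Uniqueness (\<open>lifts_unique\<close>): the quotient of two lifts is a map into \<open>H\<close>, hence into every \<open>K\<^sub>j\<close>,
and these meet only in the unit.

Homotopy invariance (\<open>homotopic_lifts_same_endpoint\<close>): if \<open>h\<close> is a homotopy of paths and \<open>l\<^sub>s\<close> lifts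
its stage \<open>s\<close>, then for \<open>s\<close> near \<open>x\<close> the path \<open>l\<^sub>x\<inverse>l\<^sub>s\<close> lies in \<open>MH\<close>, by compactness of the unit
interval; so the endpoint of \<open>l\<^sub>s\<close> modulo \<open>K\<^sub>j\<close> is locally constant in \<open>s\<close>. Only paths have to be lifted,
never squares.

Continuity (\<open>lifting_criterion\<close>): lifts of short paths end near their starting point, uniformly
enough to make the lift defined by endpoints of lifted paths continuous.

Existence of path lifts is the remaining point. Modulo a single \<open>K\<^sub>j\<close> the path is lifted over small
intervals by means of a small neighbourhood of the unit, and the pieces are joined by bisection
(\<open>path_lifting_modulo\<close>). The lifts modulo all the \<open>K\<^sub>j\<close> are compatible because they agree modulo \<open>H\<close>;
as \<open>H\<close> is the full product they come from one function into \<open>G\<close>, and this function is continuous because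
the finite intersections of the \<open>K\<^sub>j\<close> are a neighbourhood base of the unit in \<open>H\<close>
(\<open>continuous_map_if_modulo\<close>, \<open>path_lifting\<close>).
\<close>

section \<open>Topological groups and their quotients\<close>

locale topgroup = group G for G (structure) +
  fixes T
  assumes topological_group: "topological_group G T"
begin

lemma topspace_eq: "topspace T = carrier G"
  using topological_group by (simp add: topological_group_def)

lemma continuous_map_mult:
  assumes "continuous_map X T f" "continuous_map X T g"
  shows "continuous_map X T (\<lambda>x. f x \<otimes> g x)"
proof -
  have "continuous_map X (prod_topology T T) (\<lambda>x. (f x, g x))"
    using assms by (simp add: continuous_map_paired)
  moreover have "continuous_map (prod_topology T T) T (\<lambda>(x, y). x \<otimes> y)"
    using topological_group by (simp add: topological_group_def)
  ultimately show ?thesis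
    using continuous_map_compose by (fastforce simp: o_def)
qed

lemma continuous_map_inv:
  assumes "continuous_map X T f"
  shows "continuous_map X T (\<lambda>x. inv (f x))"
  using continuous_map_compose[OF assms, of T "\<lambda>x. inv x"] topological_group
  by (simp add: topological_group_def o_def)

lemma continuous_map_carrier:
  "continuous_map X T f \<Longrightarrow> x \<in> topspace X \<Longrightarrow> f x \<in> carrier G"
  using topspace_eq continuous_map_funspace by fastforce

lemma open_carrier: "openin T U \<Longrightarrow> x \<in> U \<Longrightarrow> x \<in> carrier G"
  using topspace_eq openin_subset by blast

lemma openin_left_translate:
  assumes "openin T U" "g \<in> carrier G"
  shows "openin T {y \<in> carrier G. g \<otimes> y \<in> U}"
proof -
  have "continuous_map T T (\<lambda>y. g \<otimes> y)"
    using assms topspace_eq by (intro continuous_map_mult) auto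
  from openin_continuous_map_preimage[OF this assms(1)] show ?thesis
    by (simp add: topspace_eq)
qed

lemma openin_right_translate:
  assumes "openin T U" "g \<in> carrier G"
  shows "openin T {y \<in> carrier G. y \<otimes> g \<in> U}"
proof -
  have "continuous_map T T (\<lambda>y. y \<otimes> g)"
    using assms topspace_eq by (intro continuous_map_mult) auto
  from openin_continuous_map_preimage[OF this assms(1)] show ?thesis
    by (simp add: topspace_eq)
qed

lemma openin_set_mult_left:
  assumes "openin T U" "S \<subseteq> carrier G"
  shows "openin T (U <#> S)"
proof -
  have "U <#> S = (\<Union>s\<in>S. {y \<in> carrier G. y \<otimes> inv s \<in> U})"
  proof (intro equalityI subsetI)
    fix y assume "y \<in> U <#> S"
    then obtain u s where us: "u \<in> U" "s \<in> S" "y = u \<otimes> s"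
      by (auto simp: set_mult_def)
    then have "u \<in> carrier G" "s \<in> carrier G" using assms open_carrier by auto
    then have "y \<in> carrier G" "y \<otimes> inv s = u" using us by (auto simp: m_assoc)
    then show "y \<in> (\<Union>s\<in>S. {y \<in> carrier G. y \<otimes> inv s \<in> U})" using us by (intro UN_I[of s]) auto
  next
    fix y assume "y \<in> (\<Union>s\<in>S. {y \<in> carrier G. y \<otimes> inv s \<in> U})"
    then obtain s where s: "s \<in> S" "y \<in> carrier G" "y \<otimes> inv s \<in> U" by auto
    then have "y = (y \<otimes> inv s) \<otimes> s" using assms by (auto simp: m_assoc)
    then show "y \<in> U <#> S" using s by (auto simp: set_mult_def)
  qed
  moreover have "openin T (\<Union>s\<in>S. {y \<in> carrier G. y \<otimes> inv s \<in> U})"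
    using assms by (intro openin_Union) (auto intro!: openin_right_translate)
  ultimately show ?thesis by simp
qed

lemma openin_set_mult_right:
  assumes "openin T U" "S \<subseteq> carrier G"
  shows "openin T (S <#> U)"
proof -
  have "S <#> U = (\<Union>s\<in>S. {y \<in> carrier G. inv s \<otimes> y \<in> U})"
  proof (intro equalityI subsetI)
    fix y assume "y \<in> S <#> U"
    then obtain u s where us: "u \<in> U" "s \<in> S" "y = s \<otimes> u"
      by (auto simp: set_mult_def)
    then have "u \<in> carrier G" "s \<in> carrier G" using assms open_carrier by auto
    then have "y \<in> carrier G" "inv s \<otimes> y = u" using us by (auto simp: m_assoc[symmetric])
    then show "y \<in> (\<Union>s\<in>S. {y \<in> carrier G. inv s \<otimes> y \<in> U})" using us by (intro UN_I[of s]) auto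
  next
    fix y assume "y \<in> (\<Union>s\<in>S. {y \<in> carrier G. inv s \<otimes> y \<in> U})"
    then obtain s where s: "s \<in> S" "y \<in> carrier G" "inv s \<otimes> y \<in> U" by auto
    then have "y = s \<otimes> (inv s \<otimes> y)" using assms by (auto simp: m_assoc[symmetric])
    then show "y \<in> S <#> U" using s by (auto simp: set_mult_def)
  qed
  moreover have "openin T (\<Union>s\<in>S. {y \<in> carrier G. inv s \<otimes> y \<in> U})"
    using assms by (intro openin_Union) (auto intro!: openin_left_translate)
  ultimately show ?thesis by simp
qed

lemma continuous_at_unit_pair:
  assumes f: "continuous_map (prod_topology T T) T f" and P: "openin T P" "f (\<one>, \<one>) \<in> P"
  shows "\<exists>M. openin T M \<and> \<one> \<in> M \<and> (\<forall>x\<in>M. \<forall>y\<in>M. f (x, y) \<in> P)"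
proof -
  let ?W = "{z \<in> topspace (prod_topology T T). f z \<in> P}"
  have "openin (prod_topology T T) ?W"
    using openin_continuous_map_preimage[OF f P(1)] .
  moreover have "(\<one>, \<one>) \<in> ?W" using P by (simp add: topspace_eq)
  ultimately obtain U V where UV: "openin T U" "openin T V" "\<one> \<in> U" "\<one> \<in> V" "U \<times> V \<subseteq> ?W"
    unfolding openin_prod_topology_alt by meson
  have "f (x, y) \<in> P" if "x \<in> U \<inter> V" "y \<in> U \<inter> V" for x y
    using subsetD[OF UV(5), of "(x, y)"] that by simp
  then show ?thesis
    using UV by (intro exI[of _ "U \<inter> V"]) auto
qed

lemma product_neighbourhood:
  assumes P: "openin T P" "\<one> \<in> P"
  shows "\<exists>M. openin T M \<and> \<one> \<in> M \<and> (\<forall>x\<in>M. \<forall>y\<in>M. x \<otimes> y \<in> P)"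
  using continuous_at_unit_pair[OF continuous_map_mult[OF continuous_map_fst continuous_map_snd] P(1)]
    P(2) by simp

lemma division_neighbourhood:
  assumes P: "openin T P" "\<one> \<in> P"
  shows "\<exists>M. openin T M \<and> \<one> \<in> M \<and> (\<forall>x\<in>M. \<forall>y\<in>M. inv x \<otimes> y \<in> P)"
  using continuous_at_unit_pair[OF continuous_map_mult[OF
      continuous_map_inv[OF continuous_map_fst] continuous_map_snd] P(1)]
    P(2) by simp

text \<open>
The three factors are needed when a difference of two points of a small neighbourhood is to be
compared with a third one; see \<open>path_lifting_modulo\<close>.
\<close>

lemma triple_division_neighbourhood:
  assumes P: "openin T P" "\<one> \<in> P"
  shows "\<exists>M. openin T M \<and> \<one> \<in> M \<and> (\<forall>x\<in>M. \<forall>y\<in>M. \<forall>z\<in>M. inv x \<otimes> (inv y \<otimes> z) \<in> P)"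
proof -
  obtain M1 where M1: "openin T M1" "\<one> \<in> M1" "\<forall>x\<in>M1. \<forall>y\<in>M1. inv x \<otimes> y \<in> P"
    using division_neighbourhood[OF P] by blast
  obtain M2 where M2: "openin T M2" "\<one> \<in> M2" "\<forall>x\<in>M2. \<forall>y\<in>M2. inv x \<otimes> y \<in> M1"
    using division_neighbourhood[OF M1(1,2)] by blast
  show ?thesis
    using M1 M2 by (intro exI[of _ "M1 \<inter> M2"]) auto
qed

text \<open>
Continuity at a point is tested with neighbourhoods of the unit only, since left translations are
homeomorphisms. All continuity proofs below use this form, because it passes well to quotients.
\<close>

lemma continuous_map_iff_division:
  assumes u: "\<And>x. x \<in> topspace X \<Longrightarrow> u x \<in> carrier G"
  shows "continuous_map X T u \<longleftrightarrow>
    (\<forall>x\<in>topspace X. \<forall>N. openin T N \<and> \<one> \<in> N \<longrightarrow>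
      (\<exists>V. openin X V \<and> x \<in> V \<and> (\<forall>y\<in>V. inv (u x) \<otimes> u y \<in> N)))" (is "_ \<longleftrightarrow> ?R")
proof
  assume cont: "continuous_map X T u"
  show ?R
  proof (intro ballI allI impI)
    fix x N assume x: "x \<in> topspace X" and N: "openin T N \<and> \<one> \<in> N"
    have "continuous_map X T (\<lambda>y. inv (u x) \<otimes> u y)"
      using cont x u by (intro continuous_map_mult) (auto simp: topspace_eq)
    from openin_continuous_map_preimage[OF this] N
    have "openin X {y \<in> topspace X. inv (u x) \<otimes> u y \<in> N}" by blast
    moreover have "x \<in> {y \<in> topspace X. inv (u x) \<otimes> u y \<in> N}" using x u N by simp
    ultimately show "\<exists>V. openin X V \<and> x \<in> V \<and> (\<forall>y\<in>V. inv (u x) \<otimes> u y \<in> N)" by blast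
  qed
next
  assume R: ?R
  show "continuous_map X T u"
    unfolding continuous_map_def
  proof (intro conjI allI impI)
    show "u \<in> topspace X \<rightarrow> topspace T" using u topspace_eq by auto
    fix U assume U: "openin T U"
    show "openin X {x \<in> topspace X. u x \<in> U}"
    proof (subst openin_subopen, intro ballI)
      fix x assume "x \<in> {x \<in> topspace X. u x \<in> U}"
      then have x: "x \<in> topspace X" "u x \<in> U" by auto
      have "openin T {y \<in> carrier G. u x \<otimes> y \<in> U}"
        using U x u by (intro openin_left_translate) auto
      with R x u obtain V where V: "openin X V" "x \<in> V"
        "\<forall>y\<in>V. inv (u x) \<otimes> u y \<in> {y \<in> carrier G. u x \<otimes> y \<in> U}"
        by (metis (no_types, lifting) mem_Collect_eq one_closed r_one)
      have "u y \<in> U" if "y \<in> V" for y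
      proof -
        have "y \<in> topspace X" using V that openin_subset by blast
        then have "u x \<otimes> (inv (u x) \<otimes> u y) = u y" using u x by (simp add: m_assoc[symmetric])
        then show ?thesis using V that by force
      qed
      then show "\<exists>V. openin X V \<and> x \<in> V \<and> V \<subseteq> {x \<in> topspace X. u x \<in> U}"
        using V openin_subset by blast
    qed
  qed
qed

lemma r_coset_eq_iff:
  assumes "K \<lhd> G" "x \<in> carrier G" "y \<in> carrier G"
  shows "K #> x = K #> y \<longleftrightarrow> inv x \<otimes> y \<in> K"
proof -
  interpret K: normal K G by fact
  have "K #> x = x <# K" "K #> y = y <# K" using K.coset_eq assms by auto
  moreover have "x <# K = y <# K \<longleftrightarrow> y \<in> x <# K"
  proof
    have "y \<otimes> \<one> \<in> y <# K" using K.one_closed unfolding l_coset_def by blast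
    then show "y \<in> x <# K" if "x <# K = y <# K" using that assms by simp
    show "x <# K = y <# K" if "y \<in> x <# K"
      using l_repr_independence[OF that _ K.is_subgroup] assms by simp
  qed
  moreover have "y \<in> x <# K \<longleftrightarrow> inv x \<otimes> y \<in> K"
  proof
    assume "y \<in> x <# K"
    then obtain k where "k \<in> K" "y = x \<otimes> k" by (auto simp: l_coset_def)
    then show "inv x \<otimes> y \<in> K" using assms by (simp add: m_assoc[symmetric])
  next
    assume "inv x \<otimes> y \<in> K"
    moreover have "y = x \<otimes> (inv x \<otimes> y)" using assms by (simp add: m_assoc[symmetric])
    ultimately show "y \<in> x <# K" unfolding l_coset_def by blast
  qed
  ultimately show ?thesis by simp
qed

lemma quotient_inv:
  assumes "K \<lhd> G" "x \<in> carrier G"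
  shows "inv\<^bsub>G Mod K\<^esub> (K #> x) = K #> inv x"
  using normal.inv_FactGroup[OF assms(1)] normal.rcos_inv[OF assms] assms
  by (auto simp: FactGroup_def RCOSETS_def)

lemma quotient_mult:
  assumes "K \<lhd> G" "x \<in> carrier G" "y \<in> carrier G"
  shows "(K #> x) \<otimes>\<^bsub>G Mod K\<^esub> (K #> y) = K #> (x \<otimes> y)"
  using normal.rcos_sum[OF assms] by (simp add: FactGroup_def)

lemma topspace_coset_topology:
  "topspace (coset_topology G T K) = (\<lambda>g. K #> g) ` carrier G"
  by (simp add: coset_topology_def topspace_eq)

lemma quotient_map_coset:
  "quotient_map T (coset_topology G T K) (\<lambda>g. K #> g)"
  unfolding coset_topology_def by (rule quotient_map_quotient_topology)

lemma coset_in_image_iff: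
  assumes "K \<lhd> G" "U \<subseteq> carrier G" "x \<in> carrier G"
  shows "K #> x \<in> (\<lambda>g. K #> g) ` U \<longleftrightarrow> x \<in> U <#> K"
proof
  assume "K #> x \<in> (\<lambda>g. K #> g) ` U"
  then obtain g where g: "g \<in> U" "K #> g = K #> x" by auto
  then have "g \<in> carrier G" using assms by auto
  then have "inv g \<otimes> x \<in> K" "x = g \<otimes> (inv g \<otimes> x)"
    using g assms r_coset_eq_iff[OF assms(1)] by (auto simp: m_assoc[symmetric])
  then show "x \<in> U <#> K" using g unfolding set_mult_def by blast
next
  assume "x \<in> U <#> K"
  then obtain g k where gk: "g \<in> U" "k \<in> K" "x = g \<otimes> k" by (auto simp: set_mult_def)
  have c: "g \<in> carrier G" "k \<in> carrier G"
    using gk assms(2) normal_imp_subgroup[OF assms(1)] subgroup.mem_carrier by auto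
  then have "K #> g = K #> x"
    using gk r_coset_eq_iff[OF assms(1)] by (simp add: m_assoc[symmetric])
  then show "K #> x \<in> (\<lambda>g. K #> g) ` U" using gk by auto
qed

lemma open_map_coset:
  assumes "K \<lhd> G"
  shows "open_map T (coset_topology G T K) (\<lambda>g. K #> g)"
  unfolding open_map_def
proof (intro allI impI)
  fix U assume U: "openin T U"
  interpret K: normal K G by fact
  have sub: "U \<subseteq> carrier G" using openin_subset[OF U] by (simp add: topspace_eq)
  then have "U <#> K \<subseteq> carrier G" by (rule setmult_subset_G) (rule K.subset)
  then have "{x \<in> topspace T. K #> x \<in> (\<lambda>g. K #> g) ` U} = U <#> K"
    using coset_in_image_iff[OF assms sub] by (auto simp: topspace_eq)
  then show "openin (coset_topology G T K) ((\<lambda>g. K #> g) ` U)"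
    unfolding coset_topology_def openin_quotient_topology
    using openin_set_mult_left[OF U K.subset] openin_subset[OF U] by auto
qed

text \<open>
The square of an open quotient map is again a quotient map, whereas for quotient maps in general
this fails; openness of the coset map is what makes multiplication on the quotient continuous.
\<close>

lemma topological_group_quotient:
  assumes "K \<lhd> G"
  shows "topological_group (G Mod K) (coset_topology G T K)"
proof -
  let ?Q = "coset_topology G T K" and ?q = "\<lambda>g. K #> g"
  interpret K: normal K G by fact
  note q = quotient_imp_continuous_map[OF quotient_map_coset[of K]]
  have qq: "quotient_map (prod_topology T T) (prod_topology ?Q ?Q) (\<lambda>(x, y). (?q x, ?q y))"
  proof (rule continuous_open_imp_quotient_map)
    show "continuous_map (prod_topology T T) (prod_topology ?Q ?Q) (\<lambda>(x, y). (?q x, ?q y))"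
      using q by (simp add: continuous_map_prod_top)
    show "open_map (prod_topology T T) (prod_topology ?Q ?Q) (\<lambda>(x, y). (?q x, ?q y))"
      unfolding open_map_def
    proof (intro allI impI)
      fix W assume W: "openin (prod_topology T T) W"
      show "openin (prod_topology ?Q ?Q) ((\<lambda>(x, y). (?q x, ?q y)) ` W)"
        unfolding openin_prod_topology_alt
      proof clarify
        fix x y assume "(x, y) \<in> W"
        with W obtain U V where UV: "openin T U" "openin T V" "x \<in> U" "y \<in> V" "U \<times> V \<subseteq> W"
          unfolding openin_prod_topology_alt by meson
        have "?q ` U \<times> ?q ` V \<subseteq> (\<lambda>(x, y). (?q x, ?q y)) ` W"
          using UV(5) by force
        moreover have "openin ?Q (?q ` U)" "openin ?Q (?q ` V)"
          using UV open_map_coset[OF assms] by (auto simp: open_map_def)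
        ultimately show "\<exists>U V. openin ?Q U \<and> openin ?Q V \<and> ?q x \<in> U \<and> ?q y \<in> V \<and>
            U \<times> V \<subseteq> (\<lambda>(x, y). (?q x, ?q y)) ` W"
          using UV by blast
      qed
    qed
    show "(\<lambda>(x, y). (?q x, ?q y)) ` topspace (prod_topology T T) = topspace (prod_topology ?Q ?Q)"
      by (force simp: topspace_coset_topology topspace_eq)
  qed
  have mult: "continuous_map (prod_topology ?Q ?Q) ?Q (\<lambda>(x, y). x \<otimes>\<^bsub>G Mod K\<^esub> y)"
  proof (rule continuous_compose_quotient_map[OF qq])
    have "continuous_map (prod_topology T T) ?Q (\<lambda>z. ?q (fst z \<otimes> snd z))"
      using continuous_map_compose[OF continuous_map_mult[OF continuous_map_fst continuous_map_snd] q]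
      by (simp add: o_def)
    then show "continuous_map (prod_topology T T) ?Q
        ((\<lambda>(x, y). x \<otimes>\<^bsub>G Mod K\<^esub> y) \<circ> (\<lambda>(x, y). (?q x, ?q y)))"
      by (rule continuous_map_eq) (auto simp: K.rcos_sum topspace_eq)
  qed
  have inv: "continuous_map ?Q ?Q (\<lambda>x. inv\<^bsub>G Mod K\<^esub> x)"
  proof (rule continuous_compose_quotient_map[OF quotient_map_coset])
    have "continuous_map T ?Q (\<lambda>z. ?q (inv z))"
      using continuous_map_compose[OF continuous_map_inv[OF continuous_map_id] q]
      by (simp add: o_def)
    then show "continuous_map T ?Q ((\<lambda>x. inv\<^bsub>G Mod K\<^esub> x) \<circ> ?q)"
      by (rule continuous_map_eq) (auto simp: quotient_inv[OF assms] topspace_eq)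
  qed
  show ?thesis
    unfolding topological_group_def using mult inv K.factorgroup_is_group
    by (auto simp: topspace_coset_topology FactGroup_def RCOSETS_def)
qed

text \<open>
Continuity into a quotient group, expressed by representatives. A function \<open>u\<close> with this property
need not be continuous itself; it only becomes so modulo \<open>K\<close>. Path lifting constructs such functions
before an actual lift is available.
\<close>

lemma continuous_map_into_quotient_iff:
  assumes "K \<lhd> G" and u: "\<And>x. x \<in> topspace X \<Longrightarrow> u x \<in> carrier G"
  shows "continuous_map X (coset_topology G T K) (\<lambda>x. K #> u x) \<longleftrightarrow>
    (\<forall>x\<in>topspace X. \<forall>N. openin T N \<and> \<one> \<in> N \<longrightarrow>
      (\<exists>V. openin X V \<and> x \<in> V \<and> (\<forall>y\<in>V. inv (u x) \<otimes> u y \<in> N <#> K)))" (is "_ \<longleftrightarrow> ?R")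
proof -
  let ?Q = "coset_topology G T K" and ?q = "\<lambda>g. K #> g"
  interpret K: normal K G by fact
  interpret Q: topgroup "G Mod K" ?Q
    using topological_group_quotient[OF assms(1)]
    by (simp add: topgroup_def topgroup_axioms_def topological_group_def)
  have one: "\<one>\<^bsub>G Mod K\<^esub> = ?q \<one>" using K.subset by (simp add: FactGroup_def)
  have "continuous_map X ?Q (\<lambda>x. ?q (u x)) \<longleftrightarrow>
    (\<forall>x\<in>topspace X. \<forall>N. openin ?Q N \<and> \<one>\<^bsub>G Mod K\<^esub> \<in> N \<longrightarrow>
      (\<exists>V. openin X V \<and> x \<in> V \<and>
        (\<forall>y\<in>V. inv\<^bsub>G Mod K\<^esub> (?q (u x)) \<otimes>\<^bsub>G Mod K\<^esub> ?q (u y) \<in> N)))"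
    by (rule Q.continuous_map_iff_division)
      (use u in \<open>auto simp: FactGroup_def RCOSETS_def\<close>)
  also have "\<dots> \<longleftrightarrow> (\<forall>x\<in>topspace X. \<forall>N. openin ?Q N \<and> ?q \<one> \<in> N \<longrightarrow>
      (\<exists>V. openin X V \<and> x \<in> V \<and> (\<forall>y\<in>V. ?q (inv (u x) \<otimes> u y) \<in> N)))"
  proof -
    have "inv\<^bsub>G Mod K\<^esub> (?q (u x)) \<otimes>\<^bsub>G Mod K\<^esub> ?q (u y) = ?q (inv (u x) \<otimes> u y)"
      if "x \<in> topspace X" "y \<in> topspace X" for x y
      using that u assms(1) quotient_mult[OF assms(1), of "inv (u x)" "u y"] by (simp add: quotient_inv)
    then show ?thesis
      unfolding one by (smt (verit, best) openin_subset subset_iff)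
  qed
  also have "\<dots> \<longleftrightarrow> ?R"
  proof (intro ball_cong refl iffI allI impI; elim conjE)
    fix x N assume x: "x \<in> topspace X" and N: "openin T N" "\<one> \<in> N"
      and *: "\<forall>N. openin ?Q N \<and> ?q \<one> \<in> N \<longrightarrow>
      (\<exists>V. openin X V \<and> x \<in> V \<and> (\<forall>y\<in>V. ?q (inv (u x) \<otimes> u y) \<in> N))"
    have "openin ?Q (?q ` N)" using open_map_coset[OF assms(1)] N by (simp add: open_map_def)
    with * N obtain V where V: "openin X V" "x \<in> V" "\<forall>y\<in>V. ?q (inv (u x) \<otimes> u y) \<in> ?q ` N"
      by blast
    have "inv (u x) \<otimes> u y \<in> N <#> K" if y: "y \<in> V" for y
    proof -
      have "inv (u x) \<otimes> u y \<in> carrier G" using x u y V openin_subset by blast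
      then show ?thesis
        using V(3) y coset_in_image_iff[OF assms(1)] openin_subset[OF N(1)] topspace_eq by blast
    qed
    then show "\<exists>V. openin X V \<and> x \<in> V \<and> (\<forall>y\<in>V. inv (u x) \<otimes> u y \<in> N <#> K)"
      using V by blast
  next
    fix x N assume x: "x \<in> topspace X" and N: "openin ?Q N" "?q \<one> \<in> N"
      and *: "\<forall>N. openin T N \<and> \<one> \<in> N \<longrightarrow>
      (\<exists>V. openin X V \<and> x \<in> V \<and> (\<forall>y\<in>V. inv (u x) \<otimes> u y \<in> N <#> K))"
    let ?N = "{g \<in> topspace T. ?q g \<in> N}"
    have "openin T ?N"
      using openin_continuous_map_preimage[OF quotient_imp_continuous_map[OF quotient_map_coset] N(1)] .
    moreover have "\<one> \<in> ?N" using N by (simp add: topspace_eq)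
    ultimately obtain V where V: "openin X V" "x \<in> V" "\<forall>y\<in>V. inv (u x) \<otimes> u y \<in> ?N <#> K"
      using * by blast
    have "?q (inv (u x) \<otimes> u y) \<in> N" if y: "y \<in> V" for y
    proof -
      have "inv (u x) \<otimes> u y \<in> carrier G" using x u y V openin_subset by blast
      then have "?q (inv (u x) \<otimes> u y) \<in> ?q ` ?N"
        using V(3) y coset_in_image_iff[OF assms(1), of ?N] topspace_eq by auto
      then show ?thesis by auto
    qed
    then show "\<exists>V. openin X V \<and> x \<in> V \<and> (\<forall>y\<in>V. ?q (inv (u x) \<otimes> u y) \<in> N)"
      using V by blast
  qed
  finally show ?thesis .
qed

end

section \<open>Lifting paths modulo an open normal subgroup of the kernel\<close>

lemma connected_unit_interval: "connected_space (top_of_set {0..1::real})"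
  by (simp add: connected_space_subtopology)

lemma pathin_reparametrise:
  assumes "pathin X g" "continuous_on {0..1} p" "p ` {0..1} \<subseteq> {0..1}"
  shows "pathin X (\<lambda>t. g (p t))"
proof -
  have "continuous_map (top_of_set {0..1}) (top_of_set {0..1}) p"
    using assms by (auto simp: continuous_map_in_subtopology)
  from continuous_map_compose[OF this] show ?thesis
    using assms by (auto simp: pathin_def o_def)
qed

lemma pathin_join:
  assumes "pathin X g" "pathin X h" "g 1 = h 0"
  shows "pathin X (\<lambda>t. if t \<le> 1/2 then g (2 * t) else h (2 * t - 1))"
  unfolding pathin_def
proof (rule continuous_map_cases_le)
  have halves: "{0..1} \<inter> {t \<in> topspace (top_of_set {0..1}). t \<le> 1/2} = {0..1/2::real}"
    "{0..1} \<inter> {t \<in> topspace (top_of_set {0..1}). 1/2 \<le> t} = {1/2..1::real}" by auto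
  show "continuous_map (top_of_set {0..1}) euclideanreal (\<lambda>t. t)"
    "continuous_map (top_of_set {0..1}) euclideanreal (\<lambda>t. 1/2)" by auto
  have "continuous_map (top_of_set {0..1/2}) (top_of_set {0..1}) (\<lambda>t::real. 2 * t)"
    by (auto simp: continuous_map_in_subtopology intro!: continuous_intros)
  from continuous_map_compose[OF this, of X g] assms
  show "continuous_map (subtopology (top_of_set {0..1}) {t \<in> topspace (top_of_set {0..1}). t \<le> 1/2})
     X (\<lambda>t. g (2 * t))"
    by (simp only: subtopology_subtopology pathin_def o_def halves)
  have "continuous_map (top_of_set {1/2..1}) (top_of_set {0..1}) (\<lambda>t::real. 2 * t - 1)"
    by (auto simp: continuous_map_in_subtopology intro!: continuous_intros)
  from continuous_map_compose[OF this, of X h] assms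
  show "continuous_map (subtopology (top_of_set {0..1}) {t \<in> topspace (top_of_set {0..1}). 1/2 \<le> t})
     X (\<lambda>t. h (2 * t - 1))"
    by (simp only: subtopology_subtopology pathin_def o_def halves)
  show "g (2 * t) = h (2 * t - 1)" if "t \<in> topspace (top_of_set {0..1})" "t = 1/2" for t
    unfolding that(2) using assms(3) by simp
qed

context topgroup
begin

text \<open>
The sets \<open>MK\<close> and \<open>M(H - K)\<close> are open and cover \<open>MH\<close>. The hypothesis on \<open>M\<close> makes them disjoint: if
\<open>mk = m'h\<close>, then \<open>m'\<inverse>m = hk\<inverse>\<close> lies in \<open>H\<close>, hence in \<open>K\<close>, and so does \<open>h\<close>. A connected
image that meets the first set therefore never reaches the second.
\<close>

lemma connected_stays_in_translates:
  assumes K: "subgroup K G" and H: "subgroup H G"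
    and M: "openin T M" "\<one> \<in> M"
    and sep: "\<And>x y. x \<in> M \<Longrightarrow> y \<in> M \<Longrightarrow> inv x \<otimes> y \<in> H \<Longrightarrow> inv x \<otimes> y \<in> K"
    and Y: "connected_space Y" "y0 \<in> topspace Y"
    and u: "continuous_map Y T u" "u y0 = \<one>" "\<And>y. y \<in> topspace Y \<Longrightarrow> u y \<in> M <#> H"
    and "K \<subseteq> H" "y \<in> topspace Y"
  shows "u y \<in> M <#> K"
proof -
  interpret K: subgroup K G by fact
  interpret H: subgroup H G by fact
  let ?A = "{y \<in> topspace Y. u y \<in> M <#> K}" and ?B = "{y \<in> topspace Y. u y \<in> M <#> (H - K)}"
  have "openin T (M <#> K)" "openin T (M <#> (H - K))"
    using M H.subset K.subset by (auto intro!: openin_set_mult_left)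
  then have "openin Y ?A" "openin Y ?B"
    using openin_continuous_map_preimage[OF u(1)] by auto
  moreover have "topspace Y \<subseteq> ?A \<union> ?B"
    using u(3) by (fastforce simp: set_mult_def)
  moreover have "?A \<inter> ?B = {}"
  proof -
    have False if "m \<in> M" "k \<in> K" "m' \<in> M" "h \<in> H" "h \<notin> K" "m \<otimes> k = m' \<otimes> h" for m k m' h
    proof -
      have c: "m \<in> carrier G" "m' \<in> carrier G" using that M open_carrier by auto
      have hk: "k \<in> H" "k \<in> carrier G" "h \<in> carrier G" using that assms by auto
      have "inv m' \<otimes> m = inv m' \<otimes> ((m \<otimes> k) \<otimes> inv k)" using c hk by (simp add: m_assoc)
      also have "\<dots> = h \<otimes> inv k" using c hk that by (simp add: m_assoc) (simp add: m_assoc[symmetric])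
      finally have e: "inv m' \<otimes> m = h \<otimes> inv k" .
      then have "inv m' \<otimes> m \<in> K" using sep[of m' m] that hk by simp
      then have "h \<otimes> inv k \<otimes> k \<in> K" using e that by simp
      then show False using that hk by (simp add: m_assoc)
    qed
    then show ?thesis unfolding set_mult_def by fastforce
  qed
  moreover have "\<one> \<otimes> \<one> \<in> M <#> K" using M K.one_closed unfolding set_mult_def by blast
  then have "y0 \<in> ?A" using Y u by simp
  ultimately have "?B = {}" using Y unfolding connected_space_def by blast
  then show ?thesis using u(3) \<open>y \<in> topspace Y\<close> \<open>topspace Y \<subseteq> ?A \<union> ?B\<close> by blast
qed

text \<open>
Neighbourhoods of the unit on which \<open>H\<close> cannot be distinguished from its open subset \<open>K\<close> by
small differences. They exist because \<open>K\<close> is the trace on \<open>H\<close> of an open set of \<open>G\<close>.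
\<close>

lemma adapted_neighbourhood:
  assumes "openin (subtopology T H) K" "\<one> \<in> K" "openin T N" "\<one> \<in> N"
  obtains M where "openin T M" "\<one> \<in> M" "M \<subseteq> N"
    "\<And>x y z. x \<in> M \<Longrightarrow> y \<in> M \<Longrightarrow> z \<in> M \<Longrightarrow> inv x \<otimes> (inv y \<otimes> z) \<in> H \<Longrightarrow> inv x \<otimes> (inv y \<otimes> z) \<in> K"
    "\<And>x y. x \<in> M \<Longrightarrow> y \<in> M \<Longrightarrow> inv x \<otimes> y \<in> H \<Longrightarrow> inv x \<otimes> y \<in> K"
proof -
  obtain P where P: "openin T P" "K = P \<inter> H" using assms(1) openin_subtopology by metis
  then obtain M where M: "openin T M" "\<one> \<in> M"
    "\<forall>x\<in>M. \<forall>y\<in>M. \<forall>z\<in>M. inv x \<otimes> (inv y \<otimes> z) \<in> P"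
    using triple_division_neighbourhood[of P] assms by auto
  have "inv x \<otimes> y \<in> P" if "x \<in> M" "y \<in> M" for x y
  proof -
    have "inv \<one> \<otimes> (inv x \<otimes> y) \<in> P" using M that by blast
    then show ?thesis using that M open_carrier by simp
  qed
  then show ?thesis
    using that[of "M \<inter> N"] M P assms by auto
qed

text \<open>
The covering map \<open>G/K \<rightarrow> G/H\<close> lifts paths. Over an interval whose image stays in a translate of
\<open>q(M)\<close>, a lift is obtained by choosing representatives in the corresponding translate of \<open>M\<close>: the choice
is ambiguous, but only by elements of \<open>K\<close>, so it is continuous modulo \<open>K\<close>. Bisection of the unit
interval reduces the general case to this one. For the joining step the lift over an interval must be
available for every prescribed initial value.
\<close>

lemma path_lifting_modulo:
  assumes H: "H \<lhd> G" and K: "K \<lhd> G" and KH: "openin (subtopology T H) K"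
    and \<alpha>: "pathin (coset_topology G T H) \<alpha>" and g: "g \<in> carrier G" "H #> g = \<alpha> 0"
  shows "\<exists>c. (\<forall>t\<in>{0..1}. c t \<in> carrier G \<and> H #> c t = \<alpha> t) \<and> c 0 = g \<and>
     pathin (coset_topology G T K) (\<lambda>t. K #> c t)"
proof -
  let ?Q = "coset_topology G T H" and ?q = "\<lambda>g. H #> g"
  interpret H: normal H G by fact
  interpret K: normal K G by fact
  obtain M where M: "openin T M" "\<one> \<in> M"
    "\<And>x y z. x \<in> M \<Longrightarrow> y \<in> M \<Longrightarrow> z \<in> M \<Longrightarrow> inv x \<otimes> (inv y \<otimes> z) \<in> H \<Longrightarrow> inv x \<otimes> (inv y \<otimes> z) \<in> K"
    using adapted_neighbourhood[OF KH K.one_closed openin_topspace]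
    by (metis one_closed topspace_eq)
  obtain M0 where M0: "openin T M0" "\<one> \<in> M0" "\<forall>x\<in>M0. \<forall>y\<in>M0. inv x \<otimes> y \<in> M"
    using division_neighbourhood[OF M(1,2)] by blast
  define lifts where "lifts a b g c \<longleftrightarrow> (\<forall>t\<in>{a..b}. c t \<in> carrier G \<and> ?q (c t) = \<alpha> t) \<and> c a = g \<and>
     continuous_map (top_of_set {a..b}) (coset_topology G T K) (\<lambda>t. K #> c t)" for a b g c
  define P where "P a b \<longleftrightarrow> (0 \<le> a \<longrightarrow> b \<le> 1 \<longrightarrow>
     (\<forall>g\<in>carrier G. ?q g = \<alpha> a \<longrightarrow> (\<exists>c. lifts a b g c)))" for a b :: real
  have "P 0 1"
  proof (rule Bolzano)
    show "(0::real) \<le> 1" by simp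
  next
    fix a b c :: real
    assume ab: "P a b" and bc: "P b c" and le: "a \<le> b" "b \<le> c"
    show "P a c"
      unfolding P_def
    proof (intro impI ballI)
      fix g assume "0 \<le> a" "c \<le> 1" "g \<in> carrier G" "?q g = \<alpha> a"
      then obtain c1 where c1: "lifts a b g c1" using ab le unfolding P_def by force
      then obtain c2 where c2: "lifts b c (c1 b) c2"
        using bc le \<open>0 \<le> a\<close> \<open>c \<le> 1\<close> unfolding P_def lifts_def by force
      let ?c = "\<lambda>t. if t \<le> b then c1 t else c2 t"
      have "continuous_map (top_of_set {a..c}) (coset_topology G T K)
          (\<lambda>t. if t \<le> b then K #> c1 t else K #> c2 t)"
      proof (rule continuous_map_cases_le)
        have e: "{a..c} \<inter> {t \<in> topspace (top_of_set {a..c}). t \<le> b} = {a..b}"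
          "{a..c} \<inter> {t \<in> topspace (top_of_set {a..c}). b \<le> t} = {b..c}" using le by auto
        show "continuous_map (subtopology (top_of_set {a..c}) {t \<in> topspace (top_of_set {a..c}). t \<le> b})
            (coset_topology G T K) (\<lambda>t. K #> c1 t)"
          using c1 unfolding lifts_def subtopology_subtopology e by blast
        show "continuous_map (subtopology (top_of_set {a..c}) {t \<in> topspace (top_of_set {a..c}). b \<le> t})
            (coset_topology G T K) (\<lambda>t. K #> c2 t)"
          using c2 unfolding lifts_def subtopology_subtopology e by blast
        show "K #> c1 t = K #> c2 t" if "t = b" for t
          using that c2 by (simp add: lifts_def)
      qed auto
      then have "continuous_map (top_of_set {a..c}) (coset_topology G T K) (\<lambda>t. K #> ?c t)"
        by (simp add: if_distrib)
      then have "lifts a c g ?c"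
        using c1 c2 le by (auto simp: lifts_def)
      then show "\<exists>c'. lifts a c g c'" by blast
    qed
  next
    fix x :: real assume x: "0 \<le> x" "x \<le> 1"
    then have "\<alpha> x \<in> topspace ?Q" using path_image_subset_topspace[OF \<alpha>] by auto
    then obtain g0 where g0: "g0 \<in> carrier G" "?q g0 = \<alpha> x"
      by (auto simp: topspace_coset_topology)
    have "openin T ({g0} <#> M0)" using M0 g0 by (intro openin_set_mult_right) auto
    then have "openin ?Q (?q ` ({g0} <#> M0))"
      using open_map_coset[OF H] by (simp add: open_map_def)
    then have op: "openin (top_of_set {0..1}) {t \<in> {0..1}. \<alpha> t \<in> ?q ` ({g0} <#> M0)}"
      using openin_continuous_map_preimage[OF \<alpha>[unfolded pathin_def]] by fastforce
    have "g0 \<otimes> \<one> \<in> {g0} <#> M0" using M0 unfolding set_mult_def by blast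
    then have "\<alpha> x \<in> ?q ` ({g0} <#> M0)" using g0 by force
    with x have "x \<in> {t \<in> {0..1}. \<alpha> t \<in> ?q ` ({g0} <#> M0)}" by simp
    with op have "\<exists>d>0. \<forall>t\<in>{0..1}. dist t x < d \<longrightarrow> t \<in> {t \<in> {0..1}. \<alpha> t \<in> ?q ` ({g0} <#> M0)}"
      unfolding openin_euclidean_subtopology_iff by (elim conjE) (erule bspec)
    then obtain d where d: "d > 0"
      "\<And>t. t \<in> {0..1} \<Longrightarrow> \<bar>t - x\<bar> < d \<Longrightarrow> \<alpha> t \<in> ?q ` ({g0} <#> M0)"
      by (auto simp: dist_real_def)
    have "P a b" if ab: "a \<le> x" "x \<le> b" "b - a < d" for a b
      unfolding P_def
    proof (intro impI ballI)
      fix g assume a0: "0 \<le> a" and b1: "b \<le> 1" and g: "g \<in> carrier G" "?q g = \<alpha> a"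
      have near: "\<exists>m\<in>M0. ?q (g0 \<otimes> m) = \<alpha> t" if "t \<in> {a..b}" for t
        using d(2)[of t] that ab a0 b1 by (force simp: set_mult_def)
      obtain ma where ma: "ma \<in> M0" "?q (g0 \<otimes> ma) = \<alpha> a"
        using near[of a] ab by auto
      have mac: "ma \<in> carrier G" using ma M0 open_carrier by blast
      have "\<exists>m\<in>M. ?q (g \<otimes> m) = \<alpha> t" if t: "t \<in> {a..b}" for t
      proof -
        obtain m where m: "m \<in> M0" "?q (g0 \<otimes> m) = \<alpha> t" using near[OF t] by blast
        have mc: "m \<in> carrier G" using m M0 open_carrier by blast
        have "?q (g \<otimes> (inv ma \<otimes> m)) = ?q g <#> ?q (inv ma \<otimes> m)"
          using g mac mc H.rcos_sum[of g "inv ma \<otimes> m"] by simp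
        also have "\<dots> = ?q (g0 \<otimes> ma) <#> ?q (inv ma \<otimes> m)" using g ma by simp
        also have "\<dots> = ?q (g0 \<otimes> ma \<otimes> (inv ma \<otimes> m))"
          using g0 mac mc by (simp add: H.rcos_sum)
        also have "g0 \<otimes> ma \<otimes> (inv ma \<otimes> m) = g0 \<otimes> m"
          using g0 mac mc by (metis inv_closed inv_solve_left m_assoc m_closed)
        finally show ?thesis using m ma M0(3) by auto
      qed
      then obtain m where m: "\<And>t. t \<in> {a..b} \<Longrightarrow> m t \<in> M \<and> ?q (g \<otimes> m t) = \<alpha> t"
        by metis
      \<comment> \<open>The representative at \<open>a\<close> is normalised so that the lift starts exactly at \<open>g\<close>.\<close>
      define n where "n t = (if t = a then \<one> else m t)" for t
      have n: "n t \<in> M" "n t \<in> carrier G" "?q (g \<otimes> n t) = \<alpha> t" if "t \<in> {a..b}" for t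
        using m[OF that] M g open_carrier[OF M(1)] by (auto simp: n_def)
      let ?c = "\<lambda>t. g \<otimes> n t"
      have Qc: "continuous_map (top_of_set {a..b}) ?Q (\<lambda>t. ?q (?c t))"
      proof (rule continuous_map_eq)
        show "continuous_map (top_of_set {a..b}) ?Q \<alpha>"
          using \<alpha> a0 b1 unfolding pathin_def
          by (metis atLeastatMost_subset_iff continuous_map_from_subtopology_mono)
      qed (simp add: n)
      have "continuous_map (top_of_set {a..b}) (coset_topology G T K) (\<lambda>t. K #> ?c t)"
      proof (subst continuous_map_into_quotient_iff[OF K])
        show "?c t \<in> carrier G" if "t \<in> topspace (top_of_set {a..b})" for t
          using that n g by simp
        show "\<forall>t\<in>topspace (top_of_set {a..b}). \<forall>N. openin T N \<and> \<one> \<in> N \<longrightarrow>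
          (\<exists>V. openin (top_of_set {a..b}) V \<and> t \<in> V \<and> (\<forall>s\<in>V. inv (?c t) \<otimes> ?c s \<in> N <#> K))"
        proof (intro ballI allI impI; elim conjE)
          fix t N assume "t \<in> topspace (top_of_set {a..b})" and N: "openin T N" "\<one> \<in> N"
          then have t: "t \<in> {a..b}" by simp
          have "\<forall>x\<in>topspace (top_of_set {a..b}). \<forall>N. openin T N \<and> \<one> \<in> N \<longrightarrow>
            (\<exists>V. openin (top_of_set {a..b}) V \<and> x \<in> V \<and> (\<forall>y\<in>V. inv (?c x) \<otimes> ?c y \<in> N <#> H))"
            by (rule iffD1[OF continuous_map_into_quotient_iff[OF H] Qc]) (use g n in simp)
          moreover have "openin T (N \<inter> M)" "\<one> \<in> N \<inter> M" using N M by auto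
          moreover have "t \<in> topspace (top_of_set {a..b})" using t by simp
          ultimately obtain V where V: "openin (top_of_set {a..b}) V" "t \<in> V"
            "\<forall>s\<in>V. inv (?c t) \<otimes> ?c s \<in> (N \<inter> M) <#> H"
            by blast
          have "inv (?c t) \<otimes> ?c s \<in> N <#> K" if s: "s \<in> V" for s
          proof -
            have s': "s \<in> {a..b}" using V s openin_subset by fastforce
            obtain m h where mh: "m \<in> N" "m \<in> M" "h \<in> H" "inv (?c t) \<otimes> ?c s = m \<otimes> h"
              using V s unfolding set_mult_def by blast
            have c: "m \<in> carrier G" "h \<in> carrier G" using mh M open_carrier by auto
            have "inv (?c t) \<otimes> ?c s = inv (n t) \<otimes> n s"
              using g n t s' by (simp add: inv_mult_group m_assoc) (simp add: m_assoc[symmetric])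
            moreover have "inv m \<otimes> (m \<otimes> h) = h"
              using c by (simp add: m_assoc[symmetric])
            ultimately have "inv m \<otimes> (inv (n t) \<otimes> n s) = h"
              using mh(4) by simp
            \<comment> \<open>The discrepancy \<open>h\<close> is a difference of three elements of \<open>M\<close> lying in \<open>H\<close>, hence in \<open>K\<close>.\<close>
            then have "h \<in> K" using M(3)[of m "n t" "n s"] mh n t s' by simp
            then show ?thesis using mh unfolding set_mult_def by blast
          qed
          then show "\<exists>V. openin (top_of_set {a..b}) V \<and> t \<in> V \<and>
              (\<forall>s\<in>V. inv (?c t) \<otimes> ?c s \<in> N <#> K)" using V by blast
        qed
      qed
      then have "lifts a b g ?c"
        using n g by (simp add: lifts_def n_def)
      then show "\<exists>c. lifts a b g c" by blast
    qed
    then show "\<exists>d>0. \<forall>a b. a \<le> x \<and> x \<le> b \<and> b - a < d \<longrightarrow> P a b" using d by blast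
  qed
  then show ?thesis
    using g unfolding P_def lifts_def pathin_def by auto
qed

end

section \<open>Lifting paths and homotopies through a prodiscrete kernel\<close>

text \<open>
The properties of a prodiscrete subgroup \<open>H\<close> that the lifting argument uses, with \<open>K i\<close> standing for the
families whose \<open>i\<close>-th coordinate is trivial. The last three assumptions say that \<open>H\<close> carries the
topology defined by the quotients \<open>H/K i\<close>, that these quotients separate its points, and that any choice
of one coset of each \<open>K i\<close> in \<open>H\<close> has a common point. Intersecting with \<open>H\<close> gives the
intersection over the empty index set the value \<open>H\<close>, as it must be when all of \<open>H\<close> is small or
\<open>I\<close> is empty.
\<close>

locale prodiscrete_system = topgroup G T for G (structure) and T +
  fixes H :: "'a set" and I :: "'i set" and K :: "'i \<Rightarrow> 'a set"
  assumes normal_H: "H \<lhd> G"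
    and normal_K: "i \<in> I \<Longrightarrow> K i \<lhd> G"
    and open_K: "i \<in> I \<Longrightarrow> openin (subtopology T H) (K i)"
    and basis_K: "openin T N \<Longrightarrow> \<one> \<in> N \<Longrightarrow> \<exists>F. finite F \<and> F \<subseteq> I \<and> H \<inter> (\<Inter>i\<in>F. K i) \<subseteq> N"
    and separated_K: "H \<inter> (\<Inter>i\<in>I. K i) \<subseteq> {\<one>}"
    and complete_K: "(\<And>i. i \<in> I \<Longrightarrow> h i \<in> H) \<Longrightarrow> \<exists>k\<in>H. \<forall>i\<in>I. inv (h i) \<otimes> k \<in> K i"
begin

abbreviation "Q \<equiv> coset_topology G T H"
abbreviation "q \<equiv> \<lambda>g. H #> g"

sublocale H: normal H G by (rule normal_H)

lemma K_subset_H: "i \<in> I \<Longrightarrow> K i \<subseteq> H"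
  using open_K[of i] openin_subset by fastforce

lemma one_in_K: "i \<in> I \<Longrightarrow> \<one> \<in> K i"
  using normal_K[of i] normal_imp_subgroup subgroup.one_closed by blast

lemma subgroup_finite_Inter:
  assumes "F \<subseteq> I"
  shows "subgroup (H \<inter> (\<Inter>i\<in>F. K i)) G"
proof -
  have "subgroup (\<Inter>(insert H (K ` F))) G"
    using assms normal_K normal_imp_subgroup H.is_subgroup
    by (intro subgroups_Inter) auto
  then show ?thesis by simp
qed

lemma openin_finite_Inter:
  assumes "F \<subseteq> I" "finite F"
  shows "openin (subtopology T H) (H \<inter> (\<Inter>i\<in>F. K i))"
proof -
  have "openin (subtopology T H) H"
    using H.subset topspace_eq by (metis inf.absorb_iff2 openin_topspace topspace_subtopology)
  then have "openin (subtopology T H) (\<Inter>(insert H (K ` F)))"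
    using assms open_K by (intro openin_Inter) auto
  then show ?thesis by simp
qed

text \<open>
Inside \<open>H\<close> the neighbourhood \<open>MK\<close> shrinks to \<open>K\<close>, because \<open>M \<inter> H \<subseteq> K\<close>: the unit is one
of the points of \<open>M\<close>.
\<close>

lemma connected_stays_in_kernel:
  assumes i: "i \<in> I" and M: "openin T M" "\<one> \<in> M"
    and sep: "\<And>x y. x \<in> M \<Longrightarrow> y \<in> M \<Longrightarrow> inv x \<otimes> y \<in> H \<Longrightarrow> inv x \<otimes> y \<in> K i"
    and Y: "connected_space Y" "y0 \<in> topspace Y"
    and u: "continuous_map Y T u" "u y0 = \<one>" "\<And>y. y \<in> topspace Y \<Longrightarrow> u y \<in> M <#> H"
    and y: "y \<in> topspace Y" "u y \<in> H"
  shows "u y \<in> K i"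
proof -
  have K: "subgroup (K i) G" using normal_K[OF i] normal_imp_subgroup by blast
  have "u y \<in> M <#> K i"
    by (rule connected_stays_in_translates[OF K H.is_subgroup M sep Y u K_subset_H[OF i] y(1)])
  then obtain m k where mk: "m \<in> M" "k \<in> K i" "u y = m \<otimes> k" by (auto simp: set_mult_def)
  have c: "m \<in> carrier G" "k \<in> carrier G" "k \<in> H"
    using mk M open_carrier K_subset_H[OF i] by auto
  have "m = u y \<otimes> inv k" using mk c by (simp add: m_assoc)
  then have "inv \<one> \<otimes> m \<in> H" using y c by simp
  then have "inv \<one> \<otimes> m \<in> K i" using sep M mk by blast
  then show ?thesis using mk c K by (simp add: subgroup.m_closed)
qed

lemma eq_if_divisions_in_K:
  assumes "x \<in> carrier G" "y \<in> carrier G" "q x = q y" "\<And>i. i \<in> I \<Longrightarrow> inv x \<otimes> y \<in> K i"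
  shows "x = y"
proof -
  have "inv x \<otimes> y \<in> H" using assms r_coset_eq_iff[OF normal_H] by simp
  then have "inv x \<otimes> y = \<one>" using separated_K assms(4) by blast
  then show ?thesis using assms(1,2) by (metis inv_closed inv_equality inv_inv)
qed

text \<open>
The map \<open>u\<inverse>v\<close> takes values in \<open>H\<close> and starts at the unit, so it stays in every \<open>K i\<close>.
\<close>

lemma lifts_unique:
  assumes Y: "connected_space Y" "y0 \<in> topspace Y"
    and u: "continuous_map Y T u" and v: "continuous_map Y T v" and "u y0 = v y0"
    and eq: "\<And>y. y \<in> topspace Y \<Longrightarrow> q (u y) = q (v y)" and y: "y \<in> topspace Y"
  shows "u y = v y"
proof (rule eq_if_divisions_in_K)
  note c = continuous_map_carrier[OF u] continuous_map_carrier[OF v]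
  show "u y \<in> carrier G" "v y \<in> carrier G" "q (u y) = q (v y)" using c eq y by auto
  fix i assume i: "i \<in> I"
  obtain M where M: "openin T M" "\<one> \<in> M"
    "\<And>x y. x \<in> M \<Longrightarrow> y \<in> M \<Longrightarrow> inv x \<otimes> y \<in> H \<Longrightarrow> inv x \<otimes> y \<in> K i"
    using adapted_neighbourhood[OF open_K[OF i] one_in_K[OF i] openin_topspace]
    by (metis one_closed topspace_eq)
  have inH: "inv (u z) \<otimes> v z \<in> H" if "z \<in> topspace Y" for z
    using eq[OF that] c[OF that] r_coset_eq_iff[OF normal_H] by simp
  show "inv (u y) \<otimes> v y \<in> K i"
  proof (rule connected_stays_in_kernel[OF i M Y, of "\<lambda>z. inv (u z) \<otimes> v z"])
    show "continuous_map Y T (\<lambda>z. inv (u z) \<otimes> v z)"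
      using u v by (intro continuous_map_mult continuous_map_inv)
    show "inv (u y0) \<otimes> v y0 = \<one>" using assms c by simp
    show "inv (u z) \<otimes> v z \<in> M <#> H" if z: "z \<in> topspace Y" for z
    proof -
      have "\<one> \<otimes> (inv (u z) \<otimes> v z) \<in> M <#> H"
        using M(2) inH[OF z] unfolding set_mult_def by blast
      then show ?thesis using c[OF z] by simp
    qed
  qed (use y inH in auto)
qed

text \<open>
The group \<open>G\<close> carries the topology of the limit of its quotients by \<open>H\<close> and by the \<open>K i\<close>. If a difference
\<open>g\<close> lies in \<open>MH\<close> and in \<open>MK\<^sub>i\<close> for finitely many \<open>i\<close>, write \<open>g = mh\<close> with \<open>h \<in> H\<close>.
Comparing this with \<open>g = m'k\<close>, \<open>k \<in> K\<^sub>i\<close>, shows that \<open>m\<inverse>m'\<close> lies in \<open>H\<close>, hence in \<open>K\<^sub>i\<close>, and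
then \<open>h \<in> K\<^sub>i\<close>. So the one factor \<open>h\<close> lies in all these \<open>K\<^sub>i\<close> at once and is small.
\<close>

lemma continuous_map_if_modulo:
  assumes u: "\<And>x. x \<in> topspace X \<Longrightarrow> u x \<in> carrier G"
    and modH: "continuous_map X Q (\<lambda>x. q (u x))"
    and modK: "\<And>i. i \<in> I \<Longrightarrow> continuous_map X (coset_topology G T (K i)) (\<lambda>x. K i #> u x)"
  shows "continuous_map X T u"
proof (subst continuous_map_iff_division[OF u], assumption, intro ballI allI impI, elim conjE)
  fix x N assume x: "x \<in> topspace X" and N: "openin T N" "\<one> \<in> N"
  obtain N1 where N1: "openin T N1" "\<one> \<in> N1" "\<forall>x\<in>N1. \<forall>y\<in>N1. x \<otimes> y \<in> N"
    using product_neighbourhood[OF N] by blast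
  obtain F where F: "finite F" "F \<subseteq> I" "H \<inter> (\<Inter>i\<in>F. K i) \<subseteq> N1"
    using basis_K[OF N1(1,2)] by blast
  obtain M where M: "openin T M" "\<one> \<in> M" "M \<subseteq> N1"
    "\<And>x y. x \<in> M \<Longrightarrow> y \<in> M \<Longrightarrow> inv x \<otimes> y \<in> H \<Longrightarrow> inv x \<otimes> y \<in> H \<inter> (\<Inter>i\<in>F. K i)"
    using adapted_neighbourhood[OF openin_finite_Inter[OF F(2,1)]
        subgroup.one_closed[OF subgroup_finite_Inter[OF F(2)]] N1(1,2)] by metis
  have nbhd: "\<exists>V. openin X V \<and> x \<in> V \<and> (\<forall>y\<in>V. inv (u x) \<otimes> u y \<in> M <#> L)"
    if L: "L \<lhd> G" "continuous_map X (coset_topology G T L) (\<lambda>x. L #> u x)" for L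
    using iffD1[OF continuous_map_into_quotient_iff[OF L(1) u] L(2)] x M by blast
  obtain VH where VH: "openin X VH" "x \<in> VH" "\<forall>y\<in>VH. inv (u x) \<otimes> u y \<in> M <#> H"
    using nbhd[OF normal_H modH] by blast
  have "\<forall>i\<in>F. \<exists>V. openin X V \<and> x \<in> V \<and> (\<forall>y\<in>V. inv (u x) \<otimes> u y \<in> M <#> K i)"
    using nbhd[OF normal_K modK] F by blast
  then obtain V where V:
    "\<And>i. i \<in> F \<Longrightarrow> openin X (V i) \<and> x \<in> V i \<and> (\<forall>y\<in>V i. inv (u x) \<otimes> u y \<in> M <#> K i)"
    by metis
  let ?V = "\<Inter>(insert VH (V ` F))"
  have "openin X ?V" using VH V F by (intro openin_Inter) auto
  moreover have "x \<in> ?V" using VH V by auto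
  moreover have "inv (u x) \<otimes> u y \<in> N" if y: "y \<in> ?V" for y
  proof -
    let ?g = "inv (u x) \<otimes> u y"
    obtain m h where mh: "m \<in> M" "h \<in> H" "?g = m \<otimes> h"
      using VH y unfolding set_mult_def by blast
    have c: "m \<in> carrier G" "h \<in> carrier G" using mh M open_carrier by auto
    have "h \<in> K i" if i: "i \<in> F" for i
    proof -
      obtain m' k where mk: "m' \<in> M" "k \<in> K i" "?g = m' \<otimes> k"
        using V[OF i] y i unfolding set_mult_def by blast
      have iI: "i \<in> I" using i F by auto
      have c': "m' \<in> carrier G" "k \<in> carrier G" "k \<in> H"
        using mk M open_carrier K_subset_H[OF iI] by auto
      have "inv m \<otimes> (m' \<otimes> k) = inv m \<otimes> (m \<otimes> h)" using mk mh by simp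
      also have "\<dots> = h" using c by (simp add: m_assoc[symmetric])
      finally have h: "(inv m \<otimes> m') \<otimes> k = h" using c c' by (simp add: m_assoc)
      then have "inv m \<otimes> m' = h \<otimes> inv k" using c c' by (simp add: inv_solve_right)
      then have "inv m \<otimes> m' \<in> H" using mh c' by simp
      then have "inv m \<otimes> m' \<in> K i" using M(4) mh mk i by blast
      then have "(inv m \<otimes> m') \<otimes> k \<in> K i"
        using mk normal_imp_subgroup[OF normal_K[OF iI]] by (simp add: subgroup.m_closed)
      then show ?thesis using h by simp
    qed
    then have "h \<in> N1" using F mh by blast
    then show ?thesis using N1 mh M(3) by auto
  qed
  ultimately show "\<exists>V. openin X V \<and> x \<in> V \<and> (\<forall>y\<in>V. inv (u x) \<otimes> u y \<in> N)" by blast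
qed

text \<open>
A representative \<open>r\<close> of \<open>\<alpha> t\<close> differs from the chosen lifts modulo the \<open>K i\<close> by elements of \<open>H\<close>.
Completeness provides a single correction \<open>k\<close> in \<open>H\<close> for all of them.
\<close>

lemma path_lifting:
  assumes \<alpha>: "pathin Q \<alpha>" and g: "g \<in> carrier G" "q g = \<alpha> 0"
  shows "\<exists>a. pathin T a \<and> a 0 = g \<and> (\<forall>t\<in>{0..1}. q (a t) = \<alpha> t)"
proof -
  have "\<forall>i\<in>I. \<exists>c. (\<forall>t\<in>{0..1}. c t \<in> carrier G \<and> q (c t) = \<alpha> t) \<and> c 0 = g \<and>
     pathin (coset_topology G T (K i)) (\<lambda>t. K i #> c t)"
    using path_lifting_modulo[OF normal_H normal_K open_K \<alpha> g] by blast
  then obtain c where c: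
    "\<And>i. i \<in> I \<Longrightarrow> (\<forall>t\<in>{0..1}. c i t \<in> carrier G \<and> q (c i t) = \<alpha> t) \<and> c i 0 = g \<and>
     pathin (coset_topology G T (K i)) (\<lambda>t. K i #> c i t)" by metis
  have "\<exists>x\<in>carrier G. q x = \<alpha> t \<and> (\<forall>i\<in>I. inv (c i t) \<otimes> x \<in> K i)" if t: "t \<in> {0..1}" for t
  proof -
    have "\<alpha> t \<in> topspace Q" using path_image_subset_topspace[OF \<alpha>] t by auto
    then obtain r where r: "r \<in> carrier G" "q r = \<alpha> t" by (auto simp: topspace_coset_topology)
    have "inv r \<otimes> c i t \<in> H" if i: "i \<in> I" for i
      using c[OF i] t r r_coset_eq_iff[OF normal_H, of r "c i t"] by simp
    then obtain k where k: "k \<in> H" "\<forall>i\<in>I. inv (inv r \<otimes> c i t) \<otimes> k \<in> K i"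
      using complete_K[of "\<lambda>i. inv r \<otimes> c i t"] by blast
    have kc: "k \<in> carrier G" using k by simp
    have "inv (c i t) \<otimes> (r \<otimes> k) \<in> K i" if i: "i \<in> I" for i
    proof -
      have "c i t \<in> carrier G" using c[OF i] t by simp
      then have "inv (inv r \<otimes> c i t) \<otimes> k = inv (c i t) \<otimes> (r \<otimes> k)"
        using r kc by (simp add: inv_mult_group m_assoc)
      then show ?thesis using k i by metis
    qed
    moreover have "inv r \<otimes> (r \<otimes> k) = k" using r kc by (simp add: m_assoc[symmetric])
    then have "q r = q (r \<otimes> k)" using r_coset_eq_iff[OF normal_H, of r "r \<otimes> k"] r k kc by simp
    ultimately show ?thesis using r kc by (intro bexI[of _ "r \<otimes> k"]) auto
  qed
  then obtain a where a: "\<And>t. t \<in> {0..1} \<Longrightarrow> a t \<in> carrier G \<and> q (a t) = \<alpha> t \<and>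
    (\<forall>i\<in>I. inv (c i t) \<otimes> a t \<in> K i)" by metis
  have "continuous_map (top_of_set {0..1}) T a"
  proof (rule continuous_map_if_modulo)
    show "continuous_map (top_of_set {0..1}) Q (\<lambda>t. q (a t))"
      by (rule continuous_map_eq[OF \<alpha>[unfolded pathin_def]]) (simp add: a)
    fix i assume i: "i \<in> I"
    show "continuous_map (top_of_set {0..1}) (coset_topology G T (K i)) (\<lambda>t. K i #> a t)"
    proof (rule continuous_map_eq)
      show "continuous_map (top_of_set {0..1}) (coset_topology G T (K i)) (\<lambda>t. K i #> c i t)"
        using c[OF i] by (simp add: pathin_def)
      show "K i #> c i t = K i #> a t" if "t \<in> topspace (top_of_set {0..1})" for t
        using that c[OF i] a[of t] i r_coset_eq_iff[OF normal_K[OF i], of "c i t" "a t"] by simp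
    qed
  qed (use a in auto)
  moreover have "g = a 0"
  proof (rule eq_if_divisions_in_K)
    show "inv g \<otimes> a 0 \<in> K i" if "i \<in> I" for i using c[OF that] a[of 0] that by force
  qed (use g a in auto)
  ultimately show ?thesis using a unfolding pathin_def by metis
qed

lemma path_lift_unique:
  assumes "pathin T a" "pathin T b" "a 0 = b 0" "\<And>t. t \<in> {0..1} \<Longrightarrow> q (a t) = q (b t)" "t \<in> {0..1}"
  shows "a t = b t"
  using lifts_unique[OF connected_unit_interval, of 0 a b t] assms by (simp add: pathin_def)

text \<open>
Each stage of the homotopy is lifted as a path, with no continuity in the homotopy parameter.
By the tube lemma, stages near a given one differ from it by a path in \<open>q(M)\<close>, so that the lifts differ
by a path in \<open>MH\<close>; its endpoint lies in \<open>H\<close> and therefore in \<open>K i\<close>. Hence the endpoints of the lifts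
are locally constant modulo \<open>K i\<close>, and a bisection shows that they are constant.
\<close>

lemma homotopic_lifts_same_endpoint:
  assumes hom: "homotopic_with (\<lambda>r. r 0 = x0 \<and> r 1 = x1) (top_of_set {0..1}) Q \<alpha> \<beta>"
    and a: "pathin T a" "\<And>t. t \<in> {0..1} \<Longrightarrow> q (a t) = \<alpha> t"
    and b: "pathin T b" "\<And>t. t \<in> {0..1} \<Longrightarrow> q (b t) = \<beta> t"
    and start: "a 0 = b 0"
  shows "a 1 = b 1"
proof -
  let ?I = "top_of_set {0..1::real}"
  interpret Q: topgroup "G Mod H" Q
    using topological_group_quotient[OF normal_H]
    by (simp add: topgroup_def topgroup_axioms_def topological_group_def)
  obtain h where h: "continuous_map (prod_topology ?I ?I) Q h"
    "\<forall>t. h (0, t) = \<alpha> t" "\<forall>t. h (1, t) = \<beta> t" "\<forall>s\<in>{0..1}. h (s, 0) = x0 \<and> h (s, 1) = x1"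
    using hom unfolding homotopic_with_def by blast
  have a0: "a 0 \<in> carrier G" using path_start_in_topspace[OF a(1)] topspace_eq by simp
  have "\<exists>l. pathin T l \<and> l 0 = a 0 \<and> (\<forall>t\<in>{0..1}. q (l t) = h (s, t))" if s: "s \<in> {0..1}" for s
  proof (rule path_lifting)
    have "continuous_map ?I (prod_topology ?I ?I) (\<lambda>t. (s, t))"
      using s by (simp add: continuous_map_paired) (intro continuous_intros)
    from continuous_map_compose[OF this h(1)]
    show "pathin Q (\<lambda>t. h (s, t))" by (simp add: pathin_def o_def)
    have "q (a 0) = h (0, 0)" using a h by simp
    then show "q (a 0) = h (s, 0)" using h(4) s by simp
  qed (rule a0)
  then obtain l where l: "\<And>s. s \<in> {0..1} \<Longrightarrow>
    pathin T (l s) \<and> l s 0 = a 0 \<and> (\<forall>t\<in>{0..1}. q (l s t) = h (s, t))" by metis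
  have lc: "l s t \<in> carrier G" if "s \<in> {0..1}" "t \<in> {0..1}" for s t
    using path_image_subset_topspace[of T "l s"] l[OF that(1)] that topspace_eq by auto
  have ends: "q (l s 1) = x1" if "s \<in> {0..1}" for s using l[OF that] h(4) that by simp
  have endsH: "inv (l s 1) \<otimes> l s' 1 \<in> H" if "s \<in> {0..1}" "s' \<in> {0..1}" for s s'
    using r_coset_eq_iff[OF normal_H lc lc, of s 1 s' 1] ends that by simp
  have "l 0 1 = l 1 1"
  proof (rule eq_if_divisions_in_K)
    fix i assume i: "i \<in> I"
    interpret Ki: normal "K i" G by (rule normal_K[OF i])
    obtain M where M: "openin T M" "\<one> \<in> M"
      "\<And>x y. x \<in> M \<Longrightarrow> y \<in> M \<Longrightarrow> inv x \<otimes> y \<in> H \<Longrightarrow> inv x \<otimes> y \<in> K i"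
      using adapted_neighbourhood[OF open_K[OF i] one_in_K[OF i] openin_topspace]
      by (metis one_closed topspace_eq)
    have Msub: "M \<subseteq> carrier G" using M open_carrier by auto
    have "0 \<le> (0::real) \<longrightarrow> (1::real) \<le> 1 \<longrightarrow> inv (l 0 1) \<otimes> l 1 1 \<in> K i"
    proof (rule Bolzano[where P = "\<lambda>s s'. 0 \<le> s \<longrightarrow> s' \<le> 1 \<longrightarrow> inv (l s 1) \<otimes> l s' 1 \<in> K i"])
      show "(0::real) \<le> 1" by simp
    next
      fix r s t :: real
      assume *: "0 \<le> r \<longrightarrow> s \<le> 1 \<longrightarrow> inv (l r 1) \<otimes> l s 1 \<in> K i"
        "0 \<le> s \<longrightarrow> t \<le> 1 \<longrightarrow> inv (l s 1) \<otimes> l t 1 \<in> K i" "r \<le> s" "s \<le> t"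
      show "0 \<le> r \<longrightarrow> t \<le> 1 \<longrightarrow> inv (l r 1) \<otimes> l t 1 \<in> K i"
      proof (intro impI)
        assume "0 \<le> r" "t \<le> 1"
        then have "(inv (l r 1) \<otimes> l s 1) \<otimes> (inv (l s 1) \<otimes> l t 1) \<in> K i"
          using * by simp
        moreover have "l r 1 \<in> carrier G" "l s 1 \<in> carrier G" "l t 1 \<in> carrier G"
          using \<open>0 \<le> r\<close> \<open>t \<le> 1\<close> * by (auto intro!: lc)
        then have "(inv (l r 1) \<otimes> l s 1) \<otimes> (inv (l s 1) \<otimes> l t 1) = inv (l r 1) \<otimes> l t 1"
          by (metis inv_closed inv_solve_left m_assoc m_closed)
        ultimately show "inv (l r 1) \<otimes> l t 1 \<in> K i" by simp
      qed
    next
      fix x :: real assume "0 \<le> x" "x \<le> 1"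
      then have x: "x \<in> {0..1}" by simp
      \<comment> \<open>The difference, in the quotient group, of the homotopy and its stage \<open>x\<close>.\<close>
      let ?D = "\<lambda>z. inv\<^bsub>G Mod H\<^esub> h (x, snd z) \<otimes>\<^bsub>G Mod H\<^esub> h z"
      let ?W = "{z \<in> topspace (prod_topology ?I ?I). ?D z \<in> q ` M}"
      have "continuous_map (prod_topology ?I ?I) (prod_topology ?I ?I) (\<lambda>z. (x, snd z))"
        using x by (auto intro!: continuous_intros)
      from continuous_map_compose[OF this h(1)]
      have "continuous_map (prod_topology ?I ?I) Q (\<lambda>z. h (x, snd z))" by (simp add: o_def)
      then have "continuous_map (prod_topology ?I ?I) Q ?D"
        using h(1) by (intro Q.continuous_map_mult Q.continuous_map_inv)
      moreover have "openin Q (q ` M)"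
        using open_map_coset[OF normal_H] M by (simp add: open_map_def)
      ultimately have W: "openin (prod_topology ?I ?I) ?W"
        by (rule openin_continuous_map_preimage)
      have D: "?D (s, t) = q (inv (l x t) \<otimes> l s t)" if "s \<in> {0..1}" "t \<in> {0..1}" for s t
      proof -
        have "?D (s, t) = inv\<^bsub>G Mod H\<^esub> (q (l x t)) \<otimes>\<^bsub>G Mod H\<^esub> q (l s t)"
          using l x that by simp
        also have "\<dots> = q (inv (l x t)) \<otimes>\<^bsub>G Mod H\<^esub> q (l s t)"
          using quotient_inv[OF normal_H lc[OF x that(2)]] by simp
        also have "\<dots> = q (inv (l x t) \<otimes> l s t)"
          by (rule quotient_mult[OF normal_H]) (use lc x that in auto)
        finally show ?thesis .
      qed
      have "{x} \<times> {0..1} \<subseteq> ?W" using D[OF x] x lc[OF x] M by auto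
      moreover have "compactin ?I {0..1}" by (simp add: compactin_subtopology)
      ultimately obtain U V where UV: "openin ?I U" "x \<in> U" "{0..1} \<subseteq> V" "U \<times> V \<subseteq> ?W"
        using tube_lemma_right[OF W, of "{0..1}" x] x by auto
      have near: "inv (l x 1) \<otimes> l s 1 \<in> K i" if s: "s \<in> U" for s
      proof -
        have s': "s \<in> {0..1}" using openin_subset[OF UV(1)] s by auto
        show ?thesis
        proof (rule connected_stays_in_kernel[OF i M connected_unit_interval, of 0
              "\<lambda>t. inv (l x t) \<otimes> l s t"])
          show "continuous_map ?I T (\<lambda>t. inv (l x t) \<otimes> l s t)"
            using l[OF x] l[OF s'] unfolding pathin_def
            by (intro continuous_map_mult continuous_map_inv) auto
          show "inv (l x 0) \<otimes> l s 0 = \<one>" using l[OF x] l[OF s'] a0 by simp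
          show "inv (l x t) \<otimes> l s t \<in> M <#> H" if "t \<in> topspace ?I" for t
          proof -
            have t: "t \<in> {0..1}" using that by simp
            then have "(s, t) \<in> ?W" using UV s by blast
            then have "q (inv (l x t) \<otimes> l s t) \<in> q ` M" using D[OF s' t] by simp
            then show ?thesis
              using coset_in_image_iff[OF normal_H Msub] lc[OF x t] lc[OF s' t] by simp
          qed
          show "inv (l x 1) \<otimes> l s 1 \<in> H" by (rule endsH[OF x s'])
        qed auto
      qed
      have "\<exists>d>0. \<forall>s\<in>{0..1}. dist s x < d \<longrightarrow> s \<in> U"
        using UV(1,2) unfolding openin_euclidean_subtopology_iff by blast
      then obtain d where d: "d > 0" "\<And>s. s \<in> {0..1} \<Longrightarrow> \<bar>s - x\<bar> < d \<Longrightarrow> s \<in> U"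
        by (auto simp: dist_real_def)
      have "inv (l r 1) \<otimes> l s 1 \<in> K i" if "r \<le> x" "x \<le> s" "s - r < d" "0 \<le> r" "s \<le> 1" for r s
      proof -
        have "r \<in> U" "s \<in> U" using that by (auto intro!: d(2))
        moreover have c: "l r 1 \<in> carrier G" "l s 1 \<in> carrier G" "l x 1 \<in> carrier G"
          using that by (auto intro!: lc)
        ultimately have "inv (inv (l x 1) \<otimes> l r 1) \<otimes> (inv (l x 1) \<otimes> l s 1) \<in> K i"
          using near by simp
        moreover have "inv (inv (l x 1) \<otimes> l r 1) \<otimes> (inv (l x 1) \<otimes> l s 1) = inv (l r 1) \<otimes> l s 1"
          using c by (simp add: inv_mult_group m_assoc) (metis inv_closed inv_solve_left m_assoc m_closed)
        ultimately show ?thesis by simp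
      qed
      then show "\<exists>d>0. \<forall>r s. r \<le> x \<and> x \<le> s \<and> s - r < d \<longrightarrow>
          0 \<le> r \<longrightarrow> s \<le> 1 \<longrightarrow> inv (l r 1) \<otimes> l s 1 \<in> K i"
        using d(1) by blast
    qed
    then show "inv (l 0 1) \<otimes> l 1 1 \<in> K i" by simp
  qed (use lc ends in auto)
  moreover have "l 0 1 = a 1"
    by (rule path_lift_unique) (use l[of 0] a h in auto)
  moreover have "l 1 1 = b 1"
    by (rule path_lift_unique) (use l[of 1] b h start in auto)
  ultimately show ?thesis by simp
qed

end

section \<open>Lifting maps from locally path connected spaces\<close>

context prodiscrete_system
begin

text \<open>
The lift of \<open>f\<close> at \<open>y\<close> is the endpoint of the lift of \<open>f\<close> along a path from \<open>y0\<close> to \<open>y\<close>. Two such paths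
form a loop, whose image is by assumption homotopic to the image of a loop in \<open>G\<close>; so its lift closes up,
and traversing it from both ends shows that the two endpoints agree. Near \<open>y\<close> the lift is
computed by appending a short path whose image stays in a small translate of \<open>q(M)\<close>, so that its lift
moves only within \<open>MK\<close> for a small finite intersection \<open>K\<close> of the kernels.
\<close>

lemma lifting_criterion:
  assumes Y: "connected_space Y" "locally_path_connected_space Y" and y0: "y0 \<in> topspace Y"
    and f: "continuous_map Y Q f" "f y0 = q \<one>"
    and loops: "\<And>\<gamma>. \<gamma> \<in> loops_at Y y0 \<Longrightarrow> \<exists>\<delta>\<in>loops_at T \<one>.
      homotopic_with (\<lambda>r. r 0 = q \<one> \<and> r 1 = q \<one>) (top_of_set {0..1}) Q (q \<circ> \<delta>) (f \<circ> \<gamma>)"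
  shows "\<exists>u. continuous_map Y T u \<and> u y0 = \<one> \<and> (\<forall>y\<in>topspace Y. q (u y) = f y)"
proof -
  have pc: "path_connected_space Y"
    using Y path_connected_eq_connected_space by blast
  have lift: "\<exists>l. pathin T l \<and> l 0 = \<one> \<and> (\<forall>t\<in>{0..1}. q (l t) = f (\<gamma> t))"
    if "pathin Y \<gamma>" "\<gamma> 0 = y0" for \<gamma>
    using path_lifting[OF pathin_compose[OF that(1) f(1)], of \<one>] that f(2) by simp
  have "\<forall>y\<in>topspace Y. \<exists>\<gamma>. pathin Y \<gamma> \<and> \<gamma> 0 = y0 \<and> \<gamma> 1 = y"
    using pc y0 unfolding path_connected_space_def by blast
  then obtain \<gamma> where \<gamma>: "\<And>y. y \<in> topspace Y \<Longrightarrow> pathin Y (\<gamma> y) \<and> \<gamma> y 0 = y0 \<and> \<gamma> y 1 = y"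
    by metis
  then have "\<forall>y\<in>topspace Y. \<exists>a. pathin T a \<and> a 0 = \<one> \<and> (\<forall>t\<in>{0..1}. q (a t) = f (\<gamma> y t))"
    using lift by blast
  then obtain a where a: "\<And>y. y \<in> topspace Y \<Longrightarrow>
      pathin T (a y) \<and> a y 0 = \<one> \<and> (\<forall>t\<in>{0..1}. q (a y t) = f (\<gamma> y t))"
    by metis
  define u where "u y = a y 1" for y
  have uc: "u y \<in> carrier G" if "y \<in> topspace Y" for y
    using path_finish_in_topspace[of T "a y"] a[OF that] by (simp add: u_def topspace_eq)
  have path_independent: "b 1 = u y"
    if y: "y \<in> topspace Y" and \<beta>: "pathin Y \<beta>" "\<beta> 0 = y0" "\<beta> 1 = y"
      and b: "pathin T b" "b 0 = \<one>" "\<And>t. t \<in> {0..1} \<Longrightarrow> q (b t) = f (\<beta> t)" for b \<beta> y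
  proof -
    \<comment> \<open>The path \<open>\<beta>\<close>, followed by the chosen path to \<open>y\<close> run backwards.\<close>
    let ?L = "\<lambda>t. if t \<le> 1/2 then \<beta> (2 * t) else \<gamma> y (1 - (2 * t - 1))"
    have "pathin Y (\<lambda>t. \<gamma> y (1 - t))"
      using \<gamma>[OF y, THEN conjunct1] by (rule pathin_reparametrise) (auto intro!: continuous_intros)
    then have L: "pathin Y ?L"
      using \<gamma>[OF y] \<beta>(3) by (intro pathin_join[OF \<beta>(1), of "\<lambda>t. \<gamma> y (1 - t)"]) simp_all
    have "?L \<in> loops_at Y y0"
      using L \<beta> \<gamma>[OF y] by (simp add: loops_at_def)
    from loops[OF this] obtain \<delta> where \<delta>: "pathin T \<delta>" "\<delta> 0 = \<one>" "\<delta> 1 = \<one>"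
      and hom: "homotopic_with (\<lambda>r. r 0 = q \<one> \<and> r 1 = q \<one>) (top_of_set {0..1}) Q (q \<circ> \<delta>) (f \<circ> ?L)"
      by (auto simp: loops_at_def)
    obtain l where l: "pathin T l" "l 0 = \<one>" "\<And>t. t \<in> {0..1} \<Longrightarrow> q (l t) = f (?L t)"
      using lift[OF L] \<beta> by auto
    have "\<delta> 1 = l 1"
      by (rule homotopic_lifts_same_endpoint[OF hom \<delta>(1) _ l(1)]) (use l \<delta> in auto)
    then have l1: "l 1 = \<one>" using \<delta> by simp
    have "b 1 = l (1 / 2)"
    proof (rule path_lift_unique[OF b(1), of "\<lambda>t. l (t / 2)" 1])
      show "pathin T (\<lambda>t. l (t / 2))"
        using l(1) by (rule pathin_reparametrise) (auto intro!: continuous_intros)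
      show "q (b t) = q (l (t / 2))" if "t \<in> {0..1}" for t
        using b(3)[OF that] l(3)[of "t / 2"] that by simp
    qed (use l b in auto)
    moreover have "a y 1 = l (1 - 1 / 2)"
    proof (rule path_lift_unique[of "a y" "\<lambda>t. l (1 - t / 2)" 1])
      show "pathin T (\<lambda>t. l (1 - t / 2))"
        using l(1) by (rule pathin_reparametrise) (auto intro!: continuous_intros)
      show "q (a y t) = q (l (1 - t / 2))" if t: "t \<in> {0..1}" for t
      proof -
        have "?L (1 - t / 2) = \<gamma> y t"
          using \<beta>(3) \<gamma>[OF y] t by (cases "t = 1") auto
        moreover have "q (l (1 - t / 2)) = f (?L (1 - t / 2))" using t by (intro l(3)) auto
        ultimately show ?thesis using a[OF y] t by simp
      qed
    qed (use a[OF y] l1 in auto)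
    ultimately show ?thesis by (simp add: u_def)
  qed
  have qu: "q (u y) = f y" if "y \<in> topspace Y" for y
    using a[OF that] \<gamma>[OF that] by (simp add: u_def)
  have "u y0 = \<one>"
    using path_independent[OF y0, of "\<lambda>t. y0" "\<lambda>t. \<one>"] y0 f(2) by (simp add: topspace_eq)
  moreover have "continuous_map Y T u"
  proof (subst continuous_map_iff_division[OF uc], assumption, intro ballI allI impI, elim conjE)
    fix y N assume y: "y \<in> topspace Y" and N: "openin T N" "\<one> \<in> N"
    obtain N1 where N1: "openin T N1" "\<one> \<in> N1" "\<forall>x\<in>N1. \<forall>y\<in>N1. x \<otimes> y \<in> N"
      using product_neighbourhood[OF N] by blast
    obtain F where F: "finite F" "F \<subseteq> I" "H \<inter> (\<Inter>i\<in>F. K i) \<subseteq> N1"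
      using basis_K[OF N1(1,2)] by blast
    let ?K = "H \<inter> (\<Inter>i\<in>F. K i)"
    obtain M where M: "openin T M" "\<one> \<in> M" "M \<subseteq> N1"
      "\<And>x y. x \<in> M \<Longrightarrow> y \<in> M \<Longrightarrow> inv x \<otimes> y \<in> H \<Longrightarrow> inv x \<otimes> y \<in> ?K"
      using adapted_neighbourhood[OF openin_finite_Inter[OF F(2,1)]
          subgroup.one_closed[OF subgroup_finite_Inter[OF F(2)]] N1(1,2)] by metis
    have Msub: "M \<subseteq> carrier G" using M open_carrier by auto
    let ?U = "{z \<in> topspace Y. f z \<in> q ` ({u y} <#> M)}"
    have "openin T ({u y} <#> M)" using M uc[OF y] by (intro openin_set_mult_right) auto
    then have "openin Q (q ` ({u y} <#> M))"
      using open_map_coset[OF normal_H] by (simp add: open_map_def)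
    then have "openin Y ?U" by (rule openin_continuous_map_preimage[OF f(1)])
    moreover have "u y \<otimes> \<one> \<in> {u y} <#> M" using M unfolding set_mult_def by blast
    then have "y \<in> ?U" using y qu[OF y] uc[OF y] by force
    ultimately obtain V where V: "openin Y V" "path_connectedin Y V" "y \<in> V" "V \<subseteq> ?U"
      using Y(2) unfolding locally_path_connected_space by meson
    have "inv (u y) \<otimes> u z \<in> N" if z: "z \<in> V" for z
    proof -
      have zY: "z \<in> topspace Y" using z V by auto
      obtain \<beta> where \<beta>: "pathin Y \<beta>" "\<beta> ` {0..1} \<subseteq> V" "\<beta> 0 = y" "\<beta> 1 = z"
        using V z unfolding path_connectedin by blast
      \<comment> \<open>The chosen path to \<open>y\<close>, followed by the short path \<open>\<beta>\<close>; \<open>?v\<close> below is its second half.\<close>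
      let ?L = "\<lambda>t. if t \<le> 1/2 then \<gamma> y (2 * t) else \<beta> (2 * t - 1)"
      have L: "pathin Y ?L" using \<gamma>[OF y] \<beta> by (intro pathin_join) auto
      obtain l where l: "pathin T l" "l 0 = \<one>" "\<And>t. t \<in> {0..1} \<Longrightarrow> q (l t) = f (?L t)"
        using lift[OF L] \<gamma>[OF y] by auto
      have l1: "l 1 = u z"
        by (rule path_independent[OF zY L]) (use \<gamma>[OF y] \<beta> l in auto)
      have "l (1 / 2) = u y"
      proof (rule path_independent[OF y, of "\<gamma> y" "\<lambda>t. l (t / 2)"])
        show "pathin T (\<lambda>t. l (t / 2))"
          using l(1) by (rule pathin_reparametrise) (auto intro!: continuous_intros)
        show "q (l (t / 2)) = f (\<gamma> y t)" if "t \<in> {0..1}" for t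
          using l(3)[of "t / 2"] that by simp
      qed (use \<gamma>[OF y] l in auto)
      let ?v = "\<lambda>t. inv (u y) \<otimes> l ((1 + t) / 2)"
      have l2: "pathin T (\<lambda>t. l ((1 + t) / 2))"
        using l(1) by (rule pathin_reparametrise) (auto intro!: continuous_intros)
      have "?v 1 \<in> M <#> ?K"
      proof (rule connected_stays_in_translates[OF subgroup_finite_Inter[OF F(2)] H.is_subgroup
            M(1,2,4) connected_unit_interval, where u = ?v and y = 1 and ?y0.0 = 0])
        show "continuous_map (top_of_set {0..1}) T ?v"
          using l2 uc[OF y] unfolding pathin_def
          by (intro continuous_map_mult) (auto simp: topspace_eq)
        show "?v 0 = \<one>" using \<open>l (1 / 2) = u y\<close> uc[OF y] by simp
        show "?v t \<in> M <#> H" if "t \<in> topspace (top_of_set {0..1})" for t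
        proof -
          have t: "t \<in> {0..1}" using that by simp
          let ?s = "l ((1 + t) / 2)"
          have sc: "?s \<in> carrier G" using path_image_subset_topspace[OF l2] t topspace_eq by auto
          have "?L ((1 + t) / 2) = \<beta> t" using \<gamma>[OF y] \<beta>(3) t by (cases "t = 0") (auto simp: add_divide_distrib)
          moreover have "q ?s = f (?L ((1 + t) / 2))" using t by (intro l(3)) auto
          ultimately have "q ?s = f (\<beta> t)" by simp
          moreover have "\<beta> t \<in> ?U" using \<beta>(2) V(4) t by blast
          ultimately obtain m where m: "m \<in> M" "q ?s = q (u y \<otimes> m)"
            by (auto simp: set_mult_def)
          have mc: "m \<in> carrier G" using m Msub by auto
          have "q (?v t) = q (inv (u y)) <#> q ?s"
            using uc[OF y] sc by (simp add: H.rcos_sum)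
          also have "\<dots> = q (inv (u y)) <#> q (u y \<otimes> m)" using m by simp
          also have "\<dots> = q m"
            using uc[OF y] mc H.rcos_sum[of "inv (u y)" "u y \<otimes> m"] by (simp add: m_assoc[symmetric])
          finally have "q (?v t) \<in> q ` M" using m by simp
          then show ?thesis
            using coset_in_image_iff[OF normal_H Msub] uc[OF y] sc by simp
        qed
      qed auto
      then obtain m k where "m \<in> N1" "k \<in> N1" "inv (u y) \<otimes> u z = m \<otimes> k"
        using M(3) F(3) l1 by (auto simp: set_mult_def)
      then show ?thesis using N1 by simp
    qed
    then show "\<exists>V. openin Y V \<and> y \<in> V \<and> (\<forall>z\<in>V. inv (u y) \<otimes> u z \<in> N)"
      using V by blast
  qed
  ultimately show ?thesis using qu by blast
qed

text \<open>
The inclusion of the images of the fundamental groups says that the image of each loop in the test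
space is homotopic to the image of a loop in \<open>G\<close>, because a homotopy class contains its
representative. Restricting the lift to the test space makes it extensional.
\<close>

lemma unique_lifting: "unique_lifting_property TYPE('y) T \<one> Q (q \<one>) q"
  unfolding unique_lifting_property_def
proof (intro conjI allI impI; (elim conjE)?)
  show "\<one> \<in> topspace T" by (simp add: topspace_eq)
  show qcont: "continuous_map T Q q" by (rule quotient_imp_continuous_map[OF quotient_map_coset])
  show "q \<one> = q \<one>" ..
  fix Y :: "'y topology" and y0 f
  assume y0: "y0 \<in> topspace Y" and Y: "connected_space Y" "locally_path_connected_space Y"
    and f: "continuous_map Y Q f" "f y0 = q \<one>"
    and sub: "induced_map Q (q \<one>) f ` fundamental_group_set Y y0
      \<subseteq> induced_map Q (q \<one>) q ` fundamental_group_set T \<one>"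
  have "\<exists>\<delta>\<in>loops_at T \<one>.
      homotopic_with (\<lambda>r. r 0 = q \<one> \<and> r 1 = q \<one>) (top_of_set {0..1}) Q (q \<circ> \<delta>) (f \<circ> \<gamma>)"
    if \<gamma>: "\<gamma> \<in> loops_at Y y0" for \<gamma>
  proof -
    have in_image: "loop_class Q (q \<one>) (f \<circ> \<gamma>) \<in> induced_map Q (q \<one>) f ` fundamental_group_set Y y0"
      using \<gamma> induced_map_loop_class[OF f \<gamma>] unfolding fundamental_group_set_def by force
    obtain \<delta> where \<delta>: "\<delta> \<in> loops_at T \<one>"
      "loop_class Q (q \<one>) (f \<circ> \<gamma>) = loop_class Q (q \<one>) (q \<circ> \<delta>)"
    proof -
      obtain c where c: "c \<in> fundamental_group_set T \<one>"
        "loop_class Q (q \<one>) (f \<circ> \<gamma>) = induced_map Q (q \<one>) q c"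
        using sub in_image by blast
      then obtain \<delta> where "\<delta> \<in> loops_at T \<one>" "c = loop_class T \<one> \<delta>"
        unfolding fundamental_group_set_def by blast
      then show ?thesis
        using that c(2) induced_map_loop_class[OF qcont refl] by metis
    qed
    have "f \<circ> \<gamma> \<in> loops_at Q (q \<one>)"
      using \<gamma> f(2) pathin_compose[OF _ f(1), of \<gamma>] unfolding loops_at_def by simp
    then have "f \<circ> \<gamma> \<in> loop_class Q (q \<one>) (q \<circ> \<delta>)"
      unfolding \<delta>(2)[symmetric] by (rule loop_class_self)
    then show ?thesis
      unfolding loop_class_def mem_Collect_eq by (rule bexI[OF _ \<delta>(1)])
  qed
  then have "\<exists>u. continuous_map Y T u \<and> u y0 = \<one> \<and> (\<forall>y\<in>topspace Y. q (u y) = f y)"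
    by (rule lifting_criterion[OF Y y0 f])
  then obtain u where
    u: "continuous_map Y T u" "u y0 = \<one>" "\<forall>y\<in>topspace Y. q (u y) = f y" by (elim exE conjE)
  show "\<exists>!f'. f' \<in> extensional (topspace Y) \<and> continuous_map Y T f' \<and> f' y0 = \<one> \<and>
      (\<forall>y\<in>topspace Y. q (f' y) = f y)"
  proof (rule ex1I)
    show "restrict u (topspace Y) \<in> extensional (topspace Y) \<and> continuous_map Y T (restrict u (topspace Y)) \<and>
        restrict u (topspace Y) y0 = \<one> \<and> (\<forall>y\<in>topspace Y. q (restrict u (topspace Y) y) = f y)"
      using u y0 continuous_map_eq[OF u(1), of "restrict u (topspace Y)"] by simp
    fix v assume v: "v \<in> extensional (topspace Y) \<and> continuous_map Y T v \<and> v y0 = \<one> \<and>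
      (\<forall>y\<in>topspace Y. q (v y) = f y)"
    show "v = restrict u (topspace Y)"
    proof (rule extensionalityI[where A = "topspace Y"])
      show "v y = restrict u (topspace Y) y" if "y \<in> topspace Y" for y
        using lifts_unique[OF Y(1) y0, of v u y] u v that by simp
    qed (use v in auto)
  qed
qed

end

text \<open>
Under the isomorphism with the product the \<open>K j\<close> correspond to the kernels of the projections. A basic
open box around the unit contains the families that are trivial at the finitely many restricted
indices, and a common point of prescribed cosets is read off on the diagonal \<open>i \<mapsto> x i i\<close>.
\<close>

lemma prodiscrete_imp_system:
  fixes G :: "('g, 'm) monoid_scheme"
  assumes G: "topological_group G T" and H: "H \<lhd> G"
    and "prodiscrete TYPE('i) TYPE('h) G T H"
  shows "\<exists>(I :: 'i set) K. prodiscrete_system G T H I K"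
proof -
  from assms(3) obtain I :: "'i set" and D :: "'i \<Rightarrow> 'h monoid" and \<psi> where
    D: "\<forall>i\<in>I. group (D i)" and iso: "\<psi> \<in> iso (product_group I D) (G\<lparr>carrier := H\<rparr>)"
    and homeo: "homeomorphic_map (product_topology (\<lambda>i. discrete_topology (carrier (D i))) I)
          (subtopology T H) \<psi>"
    and normal: "\<forall>j\<in>I. \<psi> ` {x \<in> carrier (product_group I D). x j = \<one>\<^bsub>D j\<^esub>} \<lhd> G"
    unfolding prodiscrete_def by blast
  interpret topgroup G T
    using G by (simp add: topgroup_def topgroup_axioms_def topological_group_def)
  interpret H: normal H G by fact
  let ?P = "product_group I D" and ?X = "product_topology (\<lambda>i. discrete_topology (carrier (D i))) I"
  define K where "K j = \<psi> ` {x \<in> carrier ?P. x j = \<one>\<^bsub>D j\<^esub>}" for j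
  interpret P: group ?P using D by simp
  have bij: "bij_betw \<psi> (carrier ?P) H" using iso by (auto simp: iso_def)
  have hom: "\<psi> (x \<otimes>\<^bsub>?P\<^esub> y) = \<psi> x \<otimes>\<^bsub>G\<^esub> \<psi> y" if "x \<in> carrier ?P" "y \<in> carrier ?P" for x y
    using iso that by (auto simp: iso_def hom_def)
  have gh: "group_hom ?P (G\<lparr>carrier := H\<rparr>) \<psi>"
    using iso H.subgroup_is_group[OF is_group]
    by (auto simp: iso_def group_hom_def group_hom_axioms_def P.is_group)
  have psi_inv: "\<psi> (inv\<^bsub>?P\<^esub> x) = inv\<^bsub>G\<^esub> \<psi> x" if "x \<in> carrier ?P" for x
    using group_hom.hom_inv[OF gh that] bij that
    by (metis H.is_subgroup bij_betwE m_inv_consistent)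
  have psi_one: "\<psi> \<one>\<^bsub>?P\<^esub> = \<one>\<^bsub>G\<^esub>" using group_hom.hom_one[OF gh] by simp
  have top: "topspace ?X = carrier ?P" by simp
  have inter: "x j = \<one>\<^bsub>D j\<^esub>" if x: "x \<in> carrier ?P" "\<psi> x \<in> K j" for x j
  proof -
    obtain x' where x': "x' \<in> carrier ?P" "x' j = \<one>\<^bsub>D j\<^esub>" "\<psi> x = \<psi> x'"
      using x(2) unfolding K_def by blast
    then have "x = x'" using bij x(1) unfolding bij_betw_def by (meson inj_onD)
    then show ?thesis using x' by simp
  qed
  have "prodiscrete_system G T H I K"
  proof (intro prodiscrete_system.intro prodiscrete_system_axioms.intro)
    show "topgroup G T" by (rule topgroup_axioms)
    show "H \<lhd> G" by fact
    show "K i \<lhd> G" if "i \<in> I" for i using normal that by (simp add: K_def)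
    show "openin (subtopology T H) (K i)" if i: "i \<in> I" for i
    proof -
      have "continuous_map ?X (discrete_topology (carrier (D i))) (\<lambda>x. x i)"
        using i by (rule continuous_map_product_projection)
      from openin_continuous_map_preimage[OF this, of "{\<one>\<^bsub>D i\<^esub>}"]
      have "openin ?X {x \<in> carrier ?P. x i = \<one>\<^bsub>D i\<^esub>}" using D i by (simp add: group.is_monoid monoid.one_closed)
      then show ?thesis
        using homeomorphic_imp_open_map[OF homeo] unfolding open_map_def K_def by blast
    qed
    show "\<exists>F. finite F \<and> F \<subseteq> I \<and> H \<inter> (\<Inter>i\<in>F. K i) \<subseteq> N" if N: "openin T N" "\<one>\<^bsub>G\<^esub> \<in> N" for N
    proof -
      have "openin (subtopology T H) (N \<inter> H)" using N openin_subtopology by blast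
      then have "openin ?X {x \<in> topspace ?X. \<psi> x \<in> N \<inter> H}"
        by (rule openin_continuous_map_preimage[OF homeomorphic_imp_continuous_map[OF homeo]])
      moreover have "\<one>\<^bsub>?P\<^esub> \<in> {x \<in> topspace ?X. \<psi> x \<in> N \<inter> H}"
        unfolding top using N psi_one H.one_closed P.one_closed by auto
      ultimately obtain U where U: "finite {i \<in> I. U i \<noteq> topspace (discrete_topology (carrier (D i)))}"
        "\<one>\<^bsub>?P\<^esub> \<in> Pi\<^sub>E I U" "Pi\<^sub>E I U \<subseteq> {x \<in> topspace ?X. \<psi> x \<in> N \<inter> H}"
        unfolding openin_product_topology_alt by meson
      let ?F = "{i \<in> I. U i \<noteq> carrier (D i)}"
      have "z \<in> N" if z: "z \<in> H" "\<And>i. i \<in> ?F \<Longrightarrow> z \<in> K i" for z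
      proof -
        obtain x where x: "x \<in> carrier ?P" "z = \<psi> x" using bij z by (auto simp: bij_betw_def)
        have "x i \<in> U i" if i: "i \<in> I" for i
        proof (cases "i \<in> ?F")
          case True
          then have "x i = \<one>\<^bsub>D i\<^esub>" using inter z x by blast
          moreover have "\<one>\<^bsub>?P\<^esub> i \<in> U i" using U(2) i by blast
          ultimately show ?thesis using i by simp
        qed (use i x in auto)
        then have "x \<in> Pi\<^sub>E I U" using x by auto
        then show ?thesis using U(3) x by blast
      qed
      then have "H \<inter> (\<Inter>i\<in>?F. K i) \<subseteq> N" by blast
      moreover have "finite ?F" using U(1) by simp
      ultimately show ?thesis by blast
    qed
    show "H \<inter> (\<Inter>i\<in>I. K i) \<subseteq> {\<one>\<^bsub>G\<^esub>}"
    proof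
      fix z assume z: "z \<in> H \<inter> (\<Inter>i\<in>I. K i)"
      then obtain x where x: "x \<in> carrier ?P" "z = \<psi> x" using bij by (auto simp: bij_betw_def)
      have "x = \<one>\<^bsub>?P\<^esub>"
        using x P.one_closed inter[OF x(1)] z
        by (intro PiE_ext[of x I "\<lambda>i. carrier (D i)"]) auto
      then show "z \<in> {\<one>\<^bsub>G\<^esub>}" using x psi_one by simp
    qed
    show "\<exists>k\<in>H. \<forall>i\<in>I. inv\<^bsub>G\<^esub> h i \<otimes>\<^bsub>G\<^esub> k \<in> K i" if h: "\<And>i. i \<in> I \<Longrightarrow> h i \<in> H" for h
    proof -
      have "\<forall>i\<in>I. \<exists>x\<in>carrier ?P. h i = \<psi> x" using h bij by (metis bij_betw_def imageE)
      then obtain x where x: "\<And>i. i \<in> I \<Longrightarrow> x i \<in> carrier ?P \<and> h i = \<psi> (x i)" by metis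
      let ?k = "\<lambda>i\<in>I. x i i"
      have k: "?k \<in> carrier ?P" using x by auto
      have "inv\<^bsub>G\<^esub> h i \<otimes>\<^bsub>G\<^esub> \<psi> ?k \<in> K i" if i: "i \<in> I" for i
      proof -
        let ?d = "inv\<^bsub>?P\<^esub> x i \<otimes>\<^bsub>?P\<^esub> ?k"
        have xi: "x i \<in> carrier ?P" "x i i \<in> carrier (D i)" using x[OF i] i by auto
        have d: "?d \<in> carrier ?P" using xi k by (intro P.m_closed P.inv_closed)
        have "?d i = (inv\<^bsub>?P\<^esub> x i) i \<otimes>\<^bsub>D i\<^esub> x i i" using i by (simp add: product_group_def)
        also have "(inv\<^bsub>?P\<^esub> x i) i = inv\<^bsub>D i\<^esub> (x i i)"
          by (subst inv_product_group) (use xi(1) D i in auto)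
        also have "\<dots> \<otimes>\<^bsub>D i\<^esub> x i i = \<one>\<^bsub>D i\<^esub>" using D i by (intro group.l_inv xi(2)) blast
        finally have "\<psi> ?d \<in> K i" using d unfolding K_def by blast
        moreover have "\<psi> ?d = inv\<^bsub>G\<^esub> h i \<otimes>\<^bsub>G\<^esub> \<psi> ?k"
          using hom[OF P.inv_closed[OF xi(1)] k] psi_inv[OF xi(1)] x[OF i] by simp
        ultimately show ?thesis by simp
      qed
      moreover have "\<psi> ?k \<in> H" using k bij bij_betwE by blast
      ultimately show ?thesis by blast
    qed
  qed
  then show ?thesis by blast
qed

theorem theorem3p7:
  fixes G :: "('g, 'm) monoid_scheme" and T :: "'g topology" and H :: "'g set"
  assumes "topological_group G T"
    and "H \<lhd> G"
    and "prodiscrete TYPE('i) TYPE('h) G T H"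
    and "connected_space (coset_topology G T H)"
    and "locally_path_connected_space (coset_topology G T H)"
  shows "topological_group (G Mod H) (coset_topology G T H) \<and>
    (\<lambda>g. H #>\<^bsub>G\<^esub> g) \<in> hom G (G Mod H) \<and>
    unique_lifting_property TYPE('y) T \<one>\<^bsub>G\<^esub> (coset_topology G T H) \<one>\<^bsub>G Mod H\<^esub> (\<lambda>g. H #>\<^bsub>G\<^esub> g) \<and>
    (connected_space T \<and> locally_path_connected_space T \<longrightarrow>
      generalized_covering_homomorphism TYPE('y) G T (G Mod H) (coset_topology G T H)
        (\<lambda>g. H #>\<^bsub>G\<^esub> g))"
proof -
  obtain I :: "'i set" and K where "prodiscrete_system G T H I K"
    using prodiscrete_imp_system[OF assms(1-3)] by blast
  then interpret prodiscrete_system G T H I K .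
  have one: "H #>\<^bsub>G\<^esub> \<one>\<^bsub>G\<^esub> = \<one>\<^bsub>G Mod H\<^esub>" by (simp add: FactGroup_def H.subset)
  note quotient = topological_group_quotient[OF normal_H] H.r_coset_hom_Mod
  have "unique_lifting_property TYPE('y) T \<one>\<^bsub>G\<^esub> (coset_topology G T H) \<one>\<^bsub>G Mod H\<^esub> (\<lambda>g. H #>\<^bsub>G\<^esub> g)"
    using unique_lifting unfolding one .
  with quotient assms(1) show ?thesis
    by (simp add: generalized_covering_homomorphism_def generalized_covering_map_def)
qed

end
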